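(* Let $v_1,\dots,v_m\in\mathbb{Z}^n$ be in general position, i.e., every $n$ of them are linearly independent, and let $Z=\sum_{i=1}^m[0,v_i]$ be $n$-dimensional. Then for $1\le i\le n$, $$\mathrm{g}_i(Z)\leq\frac{\binom{m}{i}}{\binom{n}{i}}\,\sigma_i(Z).$$
   Context: $\mathrm{g}_i(Z)$ is the coefficient of $k^i$ in the Ehrhart polynomial $k\mapsto\#(kZ\cap\mathbb{Z}^n)$. For a $0$-symmetric convex body $K$, $\lambda_i(K)=\min\{\lambda>0:\dim(\lambda K\cap\mathbb{Z}^n)\ge i\}$ (dimension of affine hull). $DZ=Z-Z$, and $\sigma_i(Z)=\sigma_i(1/\lambda_1(DZ),\dots,1/\lambda_n(DZ))$ with $\sigma_i$ the $i$th elementary symmetric polynomial. *)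

theory Defs
  imports "HOL-Analysis.Analysis" "HOL-Computational_Algebra.Polynomial"
begin

text \<open>The integer lattice Z^n inside R^n.\<close>
definition lattice :: "(real ^ 'n) set" where
  "lattice = {x. \<forall>j. x $ j \<in> \<int>}"

text \<open>The zonotope sum_{i<m} [0, v_i].\<close>
definition zonotope :: "(nat \<Rightarrow> real ^ 'n) \<Rightarrow> nat \<Rightarrow> (real ^ 'n) set" where
  "zonotope v m = {(\<Sum>i<m. t i *\<^sub>R v i) | t. \<forall>i<m. 0 \<le> t i \<and> t i \<le> 1}"

text \<open>Lattice point enumerator of the k-th dilate.\<close>
definition lattice_count :: "(real ^ 'n) set \<Rightarrow> nat \<Rightarrow> nat" where
  "lattice_count Z k = card (((*\<^sub>R) (real k) ` Z) \<inter> lattice)"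

text \<open>Ehrhart polynomial and its coefficients g_i.\<close>
definition ehrhart_poly :: "(real ^ 'n) set \<Rightarrow> real poly" where
  "ehrhart_poly Z = (THE p. \<forall>k::nat. poly p (real k) = real (lattice_count Z k))"

definition ehrhart_coeff :: "nat \<Rightarrow> (real ^ 'n) set \<Rightarrow> real" where
  "ehrhart_coeff i Z = coeff (ehrhart_poly Z) i"

text \<open>Difference body DZ = Z - Z.\<close>
definition diff_body :: "(real ^ 'n) set \<Rightarrow> (real ^ 'n) set" where
  "diff_body Z = {x - y | x y. x \<in> Z \<and> y \<in> Z}"

text \<open>Successive minima lambda_i(K) w.r.t. Z^n (dimension = affine dimension).\<close>
definition succ_min :: "nat \<Rightarrow> (real ^ 'n) set \<Rightarrow> real" where
  "succ_min i K = Inf {l. l > 0 \<and> aff_dim (((*\<^sub>R) l ` K) \<inter> lattice) \<ge> int i}"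

text \<open>Elementary symmetric polynomial sigma_i of x_1..x_n.\<close>
definition elem_sym :: "nat \<Rightarrow> nat \<Rightarrow> (nat \<Rightarrow> real) \<Rightarrow> real" where
  "elem_sym i n x = (\<Sum>S | S \<subseteq> {1..n} \<and> card S = i. \<Prod>j\<in>S. x j)"

text \<open>sigma_i(Z) = sigma_i(1/lambda_1(DZ), ..., 1/lambda_n(DZ)).\<close>
definition sigma_Z :: "nat \<Rightarrow> (real ^ 'n) set \<Rightarrow> real" where
  "sigma_Z i Z = elem_sym i CARD('n) (\<lambda>j. 1 / succ_min j (diff_body Z))"

end

(* The Ehrhart coefficient g_i of the zonotope is the sum over the i-subsets S of the
   generators of g(S), the number of lattice points sum_{s in S} t_s v_s with t in [0,1)^S;
   this follows by deletion and contraction, i.e. by counting lattice points of subzonotopes modulo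
   the span of some of the generators. The average of sum_{S <= J} g(S) over all n-subsets J is
   g_i(Z) * C(n,i) / C(m,i), so it suffices to bound this sum by sigma_i(Z) for each J.

   In the basis (v_j), j in J, the lattice becomes some L containing Z^n, and L-points of sup norm below
   lambda_k span a space of dimension below k. Eliminating coordinates from the top yields an
   ordering w : J -> {1..n} of the coordinates such that on those points the k-th coordinate is a combination
   of the preceding ones. For each S this triangular system restricts to S, and a discretised
   form of the proof of Minkowski's second theorem for the cube gives
   g(S) * prod_{j in S} lambda_{w j} <= 1. Summing over S <= J yields sigma_i exactly. *)

theory Submission
  imports Defs
begin

section \<open>Lattice points of zonotopes modulo subspaces\<close>

text \<open>Bounding every g(S) by the i largest reciprocals would give only C(n,i) / (lambda_1 ...
  lambda_i). To reach sigma_i, different S must be charged to different i-sets of minima, so one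
  bijection between coordinates and minima is fixed for all S before any volume is estimated. The
  coordinates remain those of J, not those of a lattice basis adapted to the minima, because S has
  to be a set of coordinates. The minima of DZ enter through one inclusion: in the coordinates of J,
  DZ contains the cube of radius 1. No factor 2^n appears, since the set that is deformed is the
  half-open unit cube, and two of its points differ by less than 1 in each coordinate. Minkowski's
  map uses centroids of sections, and measuring its image requires some regularity of these. On a
  grid any choice of a cell in each section will do: the map is affine on each cell and sends cells
  to boxes of known volume. The price is a boundary layer, handled by shrinking the cube by a factor
  s < 1 and letting s tend to 1.\<close>

lemma lattice_diff: "x \<in> lattice \<Longrightarrow> y \<in> lattice \<Longrightarrow> x - y \<in> lattice"
  by (auto simp: lattice_def)

lemma lattice_add: "x \<in> lattice \<Longrightarrow> y \<in> lattice \<Longrightarrow> x + y \<in> lattice"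
  by (auto simp: lattice_def)

lemma zero_in_lattice: "0 \<in> lattice"
  by (auto simp: lattice_def)

lemma lattice_scale_int: "x \<in> lattice \<Longrightarrow> of_int k *\<^sub>R x \<in> lattice"
  by (auto simp: lattice_def)

lemma finite_lattice_bounded:
  fixes S :: "(real ^ 'n) set"
  assumes "bounded S"
  shows "finite (lattice \<inter> S)"
proof -
  obtain K where K: "\<And>x. x \<in> S \<Longrightarrow> norm x \<le> K"
    using assms by (auto simp: bounded_iff)
  let ?F = "{k::real. k \<in> \<int> \<and> \<bar>k\<bar> \<le> K}"
  have "lattice \<inter> S \<subseteq> vec_lambda ` (PiE (UNIV::'n set) (\<lambda>_. ?F))"
  proof
    fix x :: "real ^ 'n" assume x: "x \<in> lattice \<inter> S"
    have "\<bar>x $ j\<bar> \<le> K" for j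
      using component_le_norm_cart[of x j] K[of x] x by auto
    then have "vec_nth x \<in> PiE UNIV (\<lambda>_. ?F)"
      using x by (auto simp: lattice_def)
    then show "x \<in> vec_lambda ` (PiE UNIV (\<lambda>_. ?F))"
      by (intro image_eqI[of _ _ "vec_nth x"]) simp_all
  qed
  moreover have "finite (PiE (UNIV::'n set) (\<lambda>_. ?F))"
    by (rule finite_PiE[OF finite finite_abs_int_segment])
  ultimately show ?thesis
    by (rule finite_subset[OF _ finite_imageI])
qed

definition zon :: "('i \<Rightarrow> real ^ 'n) \<Rightarrow> real \<Rightarrow> 'i set \<Rightarrow> (real ^ 'n) set" where
  "zon v c A = {(\<Sum>i\<in>A. t i *\<^sub>R v i) | t. \<forall>i\<in>A. 0 \<le> t i \<and> t i \<le> c}"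

text \<open>The preimage in R^n of the projected lattice, for the quotient by the span of the
  contracted generators \<open>B\<close>. Preimages and cosets stand in for points of the quotient
  throughout.\<close>

definition mod_span :: "('i \<Rightarrow> real ^ 'n) \<Rightarrow> 'i set \<Rightarrow> (real ^ 'n) set" where
  "mod_span v B = {x + w | x w. x \<in> lattice \<and> w \<in> span (v ` B)}"

text \<open>For lattice vectors this is a group of reals containing Z. When finite, the number of
  its elements in [0,1) is the lattice length of the image of \<open>v a\<close> in the quotient,
  the factor that contraction of \<open>a\<close> contributes.\<close>

definition steps :: "('i \<Rightarrow> real ^ 'n) \<Rightarrow> 'i set \<Rightarrow> 'i \<Rightarrow> real set" where
  "steps v B a = {t. t *\<^sub>R v a \<in> mod_span v B}"

text \<open>If the vectors are dependent modulo the span of \<open>v ` B\<close>, this set and the set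
  \<open>steps v B a \<inter> {0..<1}\<close> of the dependent vector are infinite and have cardinality
  \<open>0\<close>, so the counting formulas below need no independence assumption.\<close>

definition frac_pts :: "('i \<Rightarrow> real ^ 'n) \<Rightarrow> 'i set \<Rightarrow> 'i set \<Rightarrow> ('i \<Rightarrow> real) set" where
  "frac_pts v B S = {t \<in> PiE S (\<lambda>_. {0..<1}). (\<Sum>s\<in>S. t s *\<^sub>R v s) \<in> mod_span v B}"

definition coset :: "'a::ab_group_add set \<Rightarrow> 'a \<Rightarrow> 'a set" where
  "coset W x = {y. y - x \<in> W}"

text \<open>Each coset is one point of the projected lattice inside the projected zonotope,
  \<open>B\<close> being contracted. For empty \<open>B\<close> these are the lattice points of the
  dilate by \<open>c\<close>.\<close>

definition zon_cosets :: "('i \<Rightarrow> real ^ 'n) \<Rightarrow> real \<Rightarrow> 'i set \<Rightarrow> 'i set \<Rightarrow> (real ^ 'n) set set" where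
  "zon_cosets v c B A =
     {coset (span (v ` B)) x | x. x \<in> mod_span v B \<and> (\<exists>z\<in>zon v c A. x - z \<in> span (v ` B))}"

lemma coset_eq_iff:
  fixes W :: "'a::real_vector set"
  assumes "subspace W"
  shows "coset W x = coset W y \<longleftrightarrow> x - y \<in> W"
proof
  assume eq: "coset W x = coset W y"
  have "x \<in> coset W x"
    using subspace_0[OF assms] by (simp add: coset_def)
  then show "x - y \<in> W" unfolding eq by (simp add: coset_def)
next
  assume xy: "x - y \<in> W"
  have "z - x \<in> W \<longleftrightarrow> z - y \<in> W" for z
  proof
    show "z - y \<in> W" if "z - x \<in> W"
      using subspace_add[OF assms that xy] by simp
    show "z - x \<in> W" if "z - y \<in> W"
      using subspace_diff[OF assms that xy] by simp
  qed
  then show "coset W x = coset W y" by (simp add: coset_def)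
qed

lemma zon_empty [simp]: "zon v c {} = {0}"
  by (auto simp: zon_def)

lemma zon_insert:
  assumes "finite A" "a \<notin> A"
  shows "zon v c (insert a A) = (\<lambda>(z, u). z + u *\<^sub>R v a) ` (zon v c A \<times> {0..c})"
proof (intro equalityI subsetI)
  fix x assume "x \<in> zon v c (insert a A)"
  then obtain t where t: "\<forall>i\<in>insert a A. 0 \<le> t i \<and> t i \<le> c" "x = (\<Sum>i\<in>insert a A. t i *\<^sub>R v i)"
    by (auto simp: zon_def)
  then have "x = (\<Sum>i\<in>A. t i *\<^sub>R v i) + t a *\<^sub>R v a"
    using assms by (simp add: add.commute)
  moreover have "(\<Sum>i\<in>A. t i *\<^sub>R v i) \<in> zon v c A"
    using t by (auto simp: zon_def)
  ultimately show "x \<in> (\<lambda>(z, u). z + u *\<^sub>R v a) ` (zon v c A \<times> {0..c})"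
    using t by (intro image_eqI[of _ _ "(\<Sum>i\<in>A. t i *\<^sub>R v i, t a)"]) auto
next
  fix x assume "x \<in> (\<lambda>(z, u). z + u *\<^sub>R v a) ` (zon v c A \<times> {0..c})"
  then obtain t u where t: "\<forall>i\<in>A. 0 \<le> t i \<and> t i \<le> c" "0 \<le> u" "u \<le> c"
      "x = (\<Sum>i\<in>A. t i *\<^sub>R v i) + u *\<^sub>R v a"
    by (auto simp: zon_def)
  have "(\<Sum>i\<in>A. (t(a := u)) i *\<^sub>R v i) = (\<Sum>i\<in>A. t i *\<^sub>R v i)"
    using assms(2) by (intro sum.cong) auto
  then have "x = (\<Sum>i\<in>insert a A. (t(a := u)) i *\<^sub>R v i)"
    using assms t(4) by (simp add: add.commute)
  moreover have "\<forall>i\<in>insert a A. 0 \<le> (t(a := u)) i \<and> (t(a := u)) i \<le> c"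
    using t by auto
  ultimately show "x \<in> zon v c (insert a A)"
    unfolding zon_def by blast
qed

lemma compact_zon: "finite A \<Longrightarrow> compact (zon v c A)"
proof (induction A rule: finite_induct)
  case (insert a A)
  have "continuous_on (zon v c A \<times> {0..c}) (\<lambda>(z, u). z + u *\<^sub>R v a)"
    by (auto intro!: continuous_intros simp: split_beta)
  with insert show ?case
    by (simp add: zon_insert compact_continuous_image compact_Times)
qed auto

lemma convex_zon: "finite A \<Longrightarrow> convex (zon v c A)"
proof (induction A rule: finite_induct)
  case (insert a A)
  have "linear (\<lambda>(z, u::real). z + u *\<^sub>R v a)"
    by (auto simp: linear_iff algebra_simps)
  with insert show ?case
    by (simp add: zon_insert convex_linear_image convex_Times)
qed auto

lemma mod_span_diff: "x \<in> mod_span v B \<Longrightarrow> y \<in> mod_span v B \<Longrightarrow> x - y \<in> mod_span v B"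
proof -
  assume "x \<in> mod_span v B" "y \<in> mod_span v B"
  then obtain p q w u where "x = p + w" "y = q + u" "p \<in> lattice" "q \<in> lattice"
      "w \<in> span (v ` B)" "u \<in> span (v ` B)"
    by (auto simp: mod_span_def)
  then show ?thesis
    unfolding mod_span_def
    by (intro CollectI exI[of _ "p - q"] exI[of _ "w - u"]) (auto simp: lattice_diff span_diff)
qed

lemma lattice_subset_mod_span: "x \<in> lattice \<Longrightarrow> x \<in> mod_span v B"
  unfolding mod_span_def by (intro CollectI exI[of _ x] exI[of _ 0]) (auto simp: span_zero)

lemma span_subset_mod_span: "x \<in> span (v ` B) \<Longrightarrow> x \<in> mod_span v B"
  unfolding mod_span_def by (intro CollectI exI[of _ 0] exI[of _ x]) (auto simp: zero_in_lattice)

lemma mod_span_add: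
  assumes "x \<in> mod_span v B" "y \<in> mod_span v B"
  shows "x + y \<in> mod_span v B"
proof -
  have "0 - y \<in> mod_span v B"
    using assms by (intro mod_span_diff) (auto intro: lattice_subset_mod_span zero_in_lattice)
  from mod_span_diff[OF assms(1) this] show ?thesis by simp
qed

lemma steps_diff: "s \<in> steps v B a \<Longrightarrow> t \<in> steps v B a \<Longrightarrow> s - t \<in> steps v B a"
  by (auto simp: steps_def scaleR_diff_left intro: mod_span_diff)

lemma of_int_in_steps: "v a \<in> lattice \<Longrightarrow> of_int k \<in> steps v B a"
  by (auto simp: steps_def intro: lattice_subset_mod_span lattice_scale_int)

section \<open>Subgroups of the reals that contain Z\<close>

lemma subgroup_ops:
  fixes D :: "real set"
  assumes diff: "\<forall>s\<in>D. \<forall>t\<in>D. s - t \<in> D" and ints: "\<forall>k. of_int k \<in> D"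
  shows "s \<in> D \<Longrightarrow> s + of_int k \<in> D" "s \<in> D \<Longrightarrow> frac s \<in> D"
proof -
  show "s + of_int k \<in> D" if "s \<in> D"
    using diff that ints[THEN spec, of "-k"] by fastforce
  show "frac s \<in> D" if "s \<in> D"
    using diff that ints[THEN spec, of "\<lfloor>s\<rfloor>"] by (simp add: frac_def)
qed

text \<open>\<open>D\<close> is a union of translates of Z, and each translate has k elements in a
  half-open window of length k, wherever the window begins. A bijection is given because the
  finiteness of the window is wanted along with its cardinality.\<close>

lemma bij_betw_subgroup_window:
  fixes D :: "real set"
  assumes diff: "\<forall>s\<in>D. \<forall>t\<in>D. s - t \<in> D" and ints: "\<forall>k. of_int k \<in> D"
  shows "bij_betw (\<lambda>(r, q). r + of_int (\<lfloor>b - r\<rfloor> + 1 + int q))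
           ((D \<inter> {0..<1}) \<times> {..<k}) (D \<inter> {b<..b + real k})"
    (is "bij_betw ?f ?A ?B")
\<comment> \<open>The least element of r + Z above b is r + floor(b - r) + 1, and q counts unit
  steps from there; the inverse recovers q as ceiling(t - b) - 1.\<close>
proof (rule bij_betw_byWitness[where f' = "\<lambda>t. (frac t, nat (\<lceil>t - b\<rceil> - 1))"])
  note D = subgroup_ops[of D, OF diff ints]
  have fl: "real_of_int \<lfloor>b - r\<rfloor> \<le> b - r" "b - r < real_of_int \<lfloor>b - r\<rfloor> + 1" for r
    by (auto simp: of_int_floor_le)
  show "\<forall>p\<in>?A. (frac (?f p), nat (\<lceil>?f p - b\<rceil> - 1)) = p"
  proof
    fix p assume "p \<in> ?A"
    then obtain r q where p: "p = (r, q)" and r: "r \<in> {0..<1}" by auto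
    define t where "t = ?f p"
    have "frac t = r"
      using r by (subst frac_unique_iff) (auto simp: t_def p)
    moreover have "\<lceil>t - b\<rceil> = int q + 1"
    proof (rule ceiling_unique)
      have "t = r + real_of_int \<lfloor>b - r\<rfloor> + 1 + real q" by (simp add: t_def p)
      then show "of_int (int q + 1) - 1 < t - b" "t - b \<le> of_int (int q + 1)"
        using fl[of r] by (simp_all only: of_int_add of_int_of_nat_eq of_int_1)
    qed
    ultimately show "(frac (?f p), nat (\<lceil>?f p - b\<rceil> - 1)) = p"
      by (subst (1 2) t_def[symmetric]) (simp add: p)
  qed
  show "\<forall>t\<in>?B. ?f (frac t, nat (\<lceil>t - b\<rceil> - 1)) = t"
  proof
    fix t assume t: "t \<in> ?B"
    then have "\<lceil>t - b\<rceil> \<ge> 1" by (simp add: one_le_ceiling)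
    then have "real (nat (\<lceil>t - b\<rceil> - 1)) = of_int \<lceil>t - b\<rceil> - 1"
      using of_nat_nat[of "\<lceil>t - b\<rceil> - 1", where 'a = real] by simp
    moreover have "\<lfloor>b - frac t\<rfloor> = \<lfloor>t\<rfloor> - \<lceil>t - b\<rceil>"
      using floor_correct[of "b - t"] by (intro floor_unique) (auto simp: frac_def ceiling_def)
    ultimately show "?f (frac t, nat (\<lceil>t - b\<rceil> - 1)) = t"
      by (simp add: frac_def)
  qed
  have "?f (r, q) \<in> ?B" if r: "r \<in> D" "r \<in> {0..<1}" "q < k" for r :: real and q
  proof -
    have "b < r + of_int (\<lfloor>b - r\<rfloor> + 1 + int q)"
      using fl[of r] unfolding of_int_add of_int_of_nat_eq of_int_1 by linarith
    moreover have "r + of_int (\<lfloor>b - r\<rfloor> + 1 + int q) \<le> b + real k"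
    proof -
      have "real q + 1 \<le> real k" using r by linarith
      then show ?thesis
        using fl[of r] unfolding of_int_add of_int_of_nat_eq of_int_1 by linarith
    qed
    ultimately show ?thesis
      using D(1)[OF r(1), of "\<lfloor>b - r\<rfloor> + 1 + int q"] by simp
  qed
  then show "?f ` ?A \<subseteq> ?B" by auto
  show "(\<lambda>t. (frac t, nat (\<lceil>t - b\<rceil> - 1))) ` ?B \<subseteq> ?A"
  proof (rule image_subsetI)
    fix t assume t: "t \<in> ?B"
    have "\<lceil>t - b\<rceil> \<le> int k" using t by (simp add: ceiling_le_iff)
    moreover have "\<lceil>t - b\<rceil> \<ge> 1" using t by (simp add: one_le_ceiling)
    ultimately have "nat (\<lceil>t - b\<rceil> - 1) < k"
      by (subst nat_less_iff) linarith+
    then show "(frac t, nat (\<lceil>t - b\<rceil> - 1)) \<in> ?A"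
      using D(2)[of t] t by (auto simp: frac_lt_1)
  qed
qed

lemma span_image_insert:
  assumes "w \<in> span (v ` insert a B)"
  obtains u r where "u \<in> span (v ` B)" "w = u + r *\<^sub>R v a"
proof -
  obtain r where "w - r *\<^sub>R v a \<in> span (v ` B)"
    using assms by (auto simp: span_breakdown_eq)
  then show thesis by (intro that[of "w - r *\<^sub>R v a" r]) auto
qed

text \<open>Forgetting the coefficient of \<open>a\<close> leads to the fractional points with
  \<open>a\<close> contracted. Over each of these, the admissible coefficients of \<open>a\<close>
  form a coset of \<open>steps v B a\<close>, and every such coset has as many elements in [0,1) as
  the group itself.\<close>

lemma card_frac_pts_insert:
  assumes "finite S" "a \<notin> S" "v a \<in> lattice"
  shows "card (frac_pts v B (insert a S))
    = card (steps v B a \<inter> {0..<1}) * card (frac_pts v (insert a B) S)"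
proof -
  define y where "y f = (\<Sum>s\<in>S. f s *\<^sub>R v s)" for f
  let ?D = "steps v B a"
  have "\<forall>s\<in>?D. \<forall>t\<in>?D. s - t \<in> ?D" "\<forall>k. of_int k \<in> ?D"
    by (simp_all add: steps_diff of_int_in_steps assms(3))
  note D = subgroup_ops[OF this]
  \<comment> \<open>A base point of the fibre over f: \<open>- r f\<close> is one admissible
    coefficient of \<open>a\<close>, and the others differ from it by elements of
    \<open>?D\<close>.\<close>
  define r where "r f = (SOME r. y f - r *\<^sub>R v a \<in> mod_span v B)" for f
  have r: "y f - r f *\<^sub>R v a \<in> mod_span v B" if "f \<in> frac_pts v (insert a B) S" for f
  proof -
    have "y f \<in> mod_span v (insert a B)" using that by (simp add: frac_pts_def y_def)
    then obtain l w where l: "y f = l + w" "l \<in> lattice" "w \<in> span (v ` insert a B)"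
      by (auto simp: mod_span_def)
    obtain u q where "u \<in> span (v ` B)" "w = u + q *\<^sub>R v a"
      using span_image_insert[OF l(3)] .
    with l have "y f - q *\<^sub>R v a \<in> mod_span v B" by (auto simp: mod_span_def)
    then show ?thesis unfolding r_def by (rule someI)
  qed
  have ycong: "y f = y g" if "\<And>s. s \<in> S \<Longrightarrow> f s = g s" for f g
    using that by (simp add: y_def)
  have rcong: "r f = r g" if "\<And>s. s \<in> S \<Longrightarrow> f s = g s" for f g
    using ycong[OF that] by (simp add: r_def)
  have iff: "y f + c *\<^sub>R v a \<in> mod_span v B \<longleftrightarrow> c + r f \<in> ?D"
    if "f \<in> frac_pts v (insert a B) S" for f c
  proof -
    have e: "y f + c *\<^sub>R v a = (y f - r f *\<^sub>R v a) + (c + r f) *\<^sub>R v a"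
      by (simp add: algebra_simps)
    have "y f + c *\<^sub>R v a - (y f - r f *\<^sub>R v a) = (c + r f) *\<^sub>R v a"
      by (simp add: algebra_simps)
    then show ?thesis
      unfolding steps_def mem_Collect_eq
      using mod_span_add[OF r[OF that], of "(c + r f) *\<^sub>R v a"]
        mod_span_diff[OF _ r[OF that], of "y f + c *\<^sub>R v a"]
      unfolding e by metis
  qed
  have ins: "(\<Sum>s\<in>insert a S. g s *\<^sub>R v s) = y g + g a *\<^sub>R v a" for g
    using assms by (simp add: y_def add.commute)
  have res: "restrict g S \<in> frac_pts v (insert a B) S" if "g \<in> frac_pts v B (insert a S)" for g
  proof -
    note g = that
    obtain l w where l: "y g + g a *\<^sub>R v a = l + w" "l \<in> lattice" "w \<in> span (v ` B)"
      using g ins[of g] unfolding frac_pts_def mod_span_def by auto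
    have "w \<in> span (v ` insert a B)"
      using l(3) span_mono[of "v ` B" "v ` insert a B"] by auto
    then have "w - g a *\<^sub>R v a \<in> span (v ` insert a B)"
      by (intro span_diff span_scale) (auto intro: span_base)
    moreover have "y g = l + (w - g a *\<^sub>R v a)" using l(1) by (simp add: algebra_simps)
    ultimately have "y g \<in> mod_span v (insert a B)" using l(2) by (auto simp: mod_span_def)
    then have "y (restrict g S) \<in> mod_span v (insert a B)"
      using ycong[of "restrict g S" g] by simp
    then show ?thesis using g by (auto simp: frac_pts_def y_def)
  qed
  let ?f = "\<lambda>(s, f). f(a := frac (s - r f))"
  let ?f' = "\<lambda>g. (frac (g a + r (restrict g S)), restrict g S)"
  let ?A = "(?D \<inter> {0..<1}) \<times> frac_pts v (insert a B) S"
  let ?B = "frac_pts v B (insert a S)"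
  have "bij_betw ?f ?A ?B"
  proof (rule bij_betw_byWitness[where f' = ?f'])
    have c1: "restrict (f(a := c)) S = f" if "f \<in> frac_pts v (insert a B) S" for f c
      using that assms(2) by (auto simp: frac_pts_def fun_eq_iff restrict_def PiE_def extensional_def)
    show "\<forall>p\<in>?A. ?f' (?f p) = p"
    proof
      fix p assume "p \<in> ?A"
      then obtain s f where p: "p = (s, f)" "s \<in> {0..<1}" "f \<in> frac_pts v (insert a B) S" by auto
      have "frac (frac (s - r f) + r f) = s"
        using p(2) by (simp add: add.commute frac_diff_simp)
      then show "?f' (?f p) = p" by (simp add: p c1)
    qed
    show "\<forall>g\<in>?B. ?f (?f' g) = g"
    proof
      fix g assume g: "g \<in> ?B"
      then have ga: "frac (g a) = g a" and ext: "g \<in> extensional (insert a S)"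
        by (auto simp: frac_pts_def PiE_def)
      have "frac (frac (g a + r (restrict g S)) - r (restrict g S)) = g a"
        using ga frac_add_simps(1)[of "g a + r (restrict g S)" "- r (restrict g S)"] by simp
      then show "?f (?f' g) = g"
        using ext by (auto simp: fun_eq_iff restrict_def extensional_def)
    qed
    show "?f ` ?A \<subseteq> ?B"
    proof (rule image_subsetI)
      fix p assume "p \<in> ?A"
      then obtain s f where p: "p = (s, f)" "s \<in> ?D" "f \<in> frac_pts v (insert a B) S" by auto
      define g where "g = f(a := frac (s - r f))"
      have "frac (s - r f) + r f \<in> ?D"
        using D(1)[OF p(2), of "- \<lfloor>s - r f\<rfloor>"] by (simp add: frac_def)
      then have "y f + frac (s - r f) *\<^sub>R v a \<in> mod_span v B"
        using iff[OF p(3)] by blast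
      moreover have "y g = y f" using assms(2) by (intro ycong) (auto simp: g_def)
      moreover have "g a = frac (s - r f)" by (simp add: g_def)
      ultimately have "(\<Sum>s\<in>insert a S. g s *\<^sub>R v s) \<in> mod_span v B"
        unfolding ins by simp
      moreover have "g \<in> PiE (insert a S) (\<lambda>_. {0..<1})"
        using p(3) by (auto simp: g_def frac_pts_def PiE_def extensional_def frac_lt_1)
      ultimately have "g \<in> ?B" by (simp add: frac_pts_def)
      then show "?f p \<in> ?B" by (simp add: p g_def)
    qed
    show "?f' ` ?B \<subseteq> ?A"
    proof (rule image_subsetI)
      fix g assume g: "g \<in> ?B"
      have "y (restrict g S) + g a *\<^sub>R v a \<in> mod_span v B"
        using g ins[of g] ycong[of "restrict g S" g] by (simp add: frac_pts_def)
      then have "g a + r (restrict g S) \<in> ?D" using iff[OF res[OF g]] by blast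
      then have "frac (g a + r (restrict g S)) \<in> ?D" by (rule D(2))
      then show "?f' g \<in> ?A" using res[OF g] by (simp add: frac_lt_1)
    qed
  qed
  from bij_betw_same_card[OF this] show ?thesis
    by (simp only: card_cartesian_product)
qed

text \<open>Projection along a subspace spanned by lattice vectors leaves the lattice discrete: the
  component in the span can be reduced modulo the lattice into the compact \<open>zon v 1 B\<close>,
  so the steps in [0,1) inject into the lattice points of a ball.\<close>

lemma finite_steps_window:
  assumes "finite B" "v ` B \<subseteq> lattice" "v a \<notin> span (v ` B)"
  shows "finite (steps v B a \<inter> {0..<1})"
proof -
  have red: "\<exists>z\<in>zon v 1 B. w - z \<in> lattice" if "w \<in> span (v ` B)" for w
    using assms(1,2) that
  proof (induction B arbitrary: w rule: finite_induct)
    case empty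
    then show ?case by (auto simp: zero_in_lattice)
  next
    case (insert b B)
    obtain u r where u: "u \<in> span (v ` B)" "w = u + r *\<^sub>R v b"
      using span_image_insert[OF insert.prems(2)] .
    obtain z where z: "z \<in> zon v 1 B" "u - z \<in> lattice"
      using insert.IH[OF _ u(1)] insert.prems(1) by auto
    have "w - (z + frac r *\<^sub>R v b) = (u - z) + of_int \<lfloor>r\<rfloor> *\<^sub>R v b"
      by (simp add: u frac_def algebra_simps)
    also have "\<dots> \<in> lattice"
      using insert.prems(1) z(2) by (intro lattice_add lattice_scale_int) auto
    finally have "w - (z + frac r *\<^sub>R v b) \<in> lattice" .
    moreover have "z + frac r *\<^sub>R v b \<in> zon v 1 (insert b B)"
      unfolding zon_insert[OF insert.hyps]
      using z(1) frac_lt_1[of r] by (intro image_eqI[of _ _ "(z, frac r)"]) auto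
    ultimately show ?case by blast
  qed
  have zon_span: "z \<in> span (v ` B)" if "z \<in> zon v 1 B" for z
    using that unfolding zon_def by (auto intro!: span_sum intro: span_scale span_base)
  let ?D = "steps v B a \<inter> {0..<1}"
  have "\<forall>t\<in>?D. \<exists>z. z \<in> zon v 1 B \<and> t *\<^sub>R v a - z \<in> lattice"
  proof
    fix t assume "t \<in> ?D"
    then obtain l w where l: "t *\<^sub>R v a = l + w" "l \<in> lattice" "w \<in> span (v ` B)"
      by (auto simp: steps_def mod_span_def)
    obtain z where z: "z \<in> zon v 1 B" "w - z \<in> lattice" using red[OF l(3)] by blast
    have "t *\<^sub>R v a - z = l + (w - z)" using l(1) by simp
    then show "\<exists>z. z \<in> zon v 1 B \<and> t *\<^sub>R v a - z \<in> lattice"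
      using z l(2) lattice_add by metis
  qed
  then obtain \<zeta> where \<zeta>: "\<And>t. t \<in> ?D \<Longrightarrow> \<zeta> t \<in> zon v 1 B"
      "\<And>t. t \<in> ?D \<Longrightarrow> t *\<^sub>R v a - \<zeta> t \<in> lattice" by metis
  obtain K where K: "\<And>z. z \<in> zon v 1 B \<Longrightarrow> norm z \<le> K"
    using compact_imp_bounded[OF compact_zon[OF assms(1), of v 1]] by (auto simp: bounded_iff)
  have "inj_on (\<lambda>t. t *\<^sub>R v a - \<zeta> t) ?D"
  proof (rule inj_onI, rule ccontr)
    fix s t assume st: "s \<in> ?D" "t \<in> ?D" "s *\<^sub>R v a - \<zeta> s = t *\<^sub>R v a - \<zeta> t" "s \<noteq> t"
    have "(s - t) *\<^sub>R v a = \<zeta> s - \<zeta> t"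
      using st(3) by (simp add: algebra_simps)
    also have "\<dots> \<in> span (v ` B)" using st \<zeta>(1) zon_span by (blast intro: span_diff)
    finally have "v a \<in> span (v ` B)"
      using span_scale[of "(s - t) *\<^sub>R v a" "v ` B" "inverse (s - t)"] st(4) by simp
    with assms(3) show False by simp
  qed
  moreover have "(\<lambda>t. t *\<^sub>R v a - \<zeta> t) ` ?D \<subseteq> lattice \<inter> cball 0 (norm (v a) + K)"
  proof (rule image_subsetI)
    fix t assume t: "t \<in> ?D"
    have "norm (t *\<^sub>R v a - \<zeta> t) \<le> \<bar>t\<bar> * norm (v a) + norm (\<zeta> t)"
      by (metis norm_triangle_ineq4 norm_scaleR)
    also have "\<dots> \<le> 1 * norm (v a) + K"
      using t K[OF \<zeta>(1)[OF t]] by (intro add_mono mult_right_mono) auto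
    finally show "t *\<^sub>R v a - \<zeta> t \<in> lattice \<inter> cball 0 (norm (v a) + K)"
      using \<zeta>(2)[OF t] by simp
  qed
  ultimately show ?thesis
    by (meson finite_lattice_bounded bounded_cball inj_on_finite)
qed

section \<open>Deletion and contraction of a generator\<close>

lemma zon_cosets_insert_in_span:
  assumes "finite A" "a \<notin> A" "v a \<in> span (v ` B)" "0 \<le> c"
  shows "zon_cosets v c B (insert a A) = zon_cosets v c B A"
proof -
  have "(\<exists>z\<in>zon v c (insert a A). x - z \<in> span (v ` B)) \<longleftrightarrow> (\<exists>z\<in>zon v c A. x - z \<in> span (v ` B))"
    for x
  proof
    assume "\<exists>z\<in>zon v c (insert a A). x - z \<in> span (v ` B)"
    then obtain z u where z: "z \<in> zon v c A" "x - (z + u *\<^sub>R v a) \<in> span (v ` B)"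
      unfolding zon_insert[OF assms(1,2)] by auto
    have "x - z = (x - (z + u *\<^sub>R v a)) + u *\<^sub>R v a" by simp
    then have "x - z \<in> span (v ` B)"
      using span_add[OF z(2) span_scale[OF assms(3), of u]] by simp
    with z(1) show "\<exists>z\<in>zon v c A. x - z \<in> span (v ` B)" by blast
  next
    assume "\<exists>z\<in>zon v c A. x - z \<in> span (v ` B)"
    then obtain z where z: "z \<in> zon v c A" "x - z \<in> span (v ` B)" by blast
    have "z \<in> zon v c (insert a A)"
      unfolding zon_insert[OF assms(1,2)]
      using z(1) assms(4) by (intro image_eqI[of _ _ "(z, 0)"]) auto
    with z(2) show "\<exists>z\<in>zon v c (insert a A). x - z \<in> span (v ` B)" by blast
  qed
  then show ?thesis by (simp add: zon_cosets_def)
qed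

text \<open>Modulo the span, a line in direction \<open>v a\<close> meets the zonotope in an
  interval with a largest element b, attained by closedness. The extra segment moves only this end,
  to b + c. The new part is half-open of length c on every line, so all lines gain equally many
  lattice points.\<close>

lemma line_through_zonotope:
  fixes v :: "'i \<Rightarrow> real ^ 'n"
  assumes "finite A" "a \<notin> A" "v a \<notin> span (v ` B)" "0 \<le> c"
    and x: "\<exists>z\<in>zon v c A. x - z \<in> span (v ` insert a B)"
  defines "T \<equiv> (\<lambda>A. {t. \<exists>z\<in>zon v c A. x + t *\<^sub>R v a - z \<in> span (v ` B)})"
  shows "\<exists>b. T (insert a A) - T A = {b<..b + c}"
proof -
  let ?W = "span (v ` B)"
  let ?T = "T A"
  have "closed (\<Union>z\<in>zon v c A. \<Union>w\<in>?W. {z + w})"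
    by (intro compact_closed_sums compact_zon closed_subspace assms subspace_span)
  moreover have "?T = (\<lambda>t. x + t *\<^sub>R v a) -` (\<Union>z\<in>zon v c A. \<Union>w\<in>?W. {z + w})"
  proof (intro equalityI subsetI)
    fix t assume "t \<in> ?T"
    then obtain z where "z \<in> zon v c A" "x + t *\<^sub>R v a - z \<in> ?W" by (auto simp: T_def)
    moreover from this have "x + t *\<^sub>R v a \<in> {z + (x + t *\<^sub>R v a - z)}" by simp
    ultimately show "t \<in> (\<lambda>t. x + t *\<^sub>R v a) -` (\<Union>z\<in>zon v c A. \<Union>w\<in>?W. {z + w})"
      by blast
  next
    fix t assume "t \<in> (\<lambda>t. x + t *\<^sub>R v a) -` (\<Union>z\<in>zon v c A. \<Union>w\<in>?W. {z + w})"
    then obtain z w where z: "z \<in> zon v c A" "w \<in> ?W" "x + t *\<^sub>R v a = z + w" by blast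
    then have "x + t *\<^sub>R v a - z \<in> ?W" by simp
    with z(1) show "t \<in> ?T" unfolding T_def by blast
  qed
  moreover have "closed ((\<lambda>t. x + t *\<^sub>R v a) -` X)" if "closed X" for X
    by (intro closed_vimage that continuous_intros)
  ultimately have "closed ?T" by metis
  \<comment> \<open>y is the component of \<open>v a\<close> orthogonal to the span. It is nonzero,
    and the inner product with y turns the bound on the zonotope into a bound on t.\<close>
  obtain w y where wy: "w \<in> ?W" "\<And>u. u \<in> ?W \<Longrightarrow> orthogonal y u" "v a = w + y"
    using orthogonal_subspace_decomp_exists[of "v ` B" "v a"] by (metis orthogonal_commute)
  have "y \<noteq> 0" using assms(3) wy by auto
  then have yy: "y \<bullet> y > 0" by simp
  have ya: "y \<bullet> v a = y \<bullet> y" using wy(2)[OF wy(1)] by (simp add: wy(3) orthogonal_def inner_add_right)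
  obtain K where K: "\<And>z. z \<in> zon v c A \<Longrightarrow> norm z \<le> K"
    using compact_imp_bounded[OF compact_zon[OF assms(1), of v c]] by (auto simp: bounded_iff)
  have "t \<le> (norm y * K - y \<bullet> x) / (y \<bullet> y)" if t: "t \<in> ?T" for t
  proof -
    obtain z where z: "z \<in> zon v c A" "x + t *\<^sub>R v a - z \<in> ?W" using t by (auto simp: T_def)
    have "y \<bullet> (x + t *\<^sub>R v a - z) = 0" using wy(2)[OF z(2)] by (simp add: orthogonal_def)
    then have "t * (y \<bullet> y) = y \<bullet> z - y \<bullet> x"
      by (simp add: inner_add_right inner_diff_right ya)
    also have "y \<bullet> z \<le> norm y * K"
      using norm_cauchy_schwarz[of y z] mult_left_mono[OF K[OF z(1)], of "norm y"] by simp
    finally show ?thesis using yy by (simp add: pos_le_divide_eq)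
  qed
  then have bdd: "bdd_above ?T" by (auto simp: bdd_above_def)
  have "?T \<noteq> {}"
  proof -
    obtain z where z: "z \<in> zon v c A" "x - z \<in> span (v ` insert a B)" using x by blast
    obtain u r where "u \<in> ?W" "x - z = u + r *\<^sub>R v a" using span_image_insert[OF z(2)] .
    then have "x + (- r) *\<^sub>R v a - z \<in> ?W" by (simp add: algebra_simps)
    with z(1) have "- r \<in> ?T" unfolding T_def by blast
    then show ?thesis by blast
  qed
  have conv: "t \<in> ?T" if st: "s \<in> ?T" "r \<in> ?T" "s \<le> t" "t \<le> r" for s t r
  proof -
    obtain z1 z2 where z: "z1 \<in> zon v c A" "x + s *\<^sub>R v a - z1 \<in> ?W"
      "z2 \<in> zon v c A" "x + r *\<^sub>R v a - z2 \<in> ?W" using st(1,2) by (auto simp: T_def)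
    have "t \<in> closed_segment s r" using st by (simp add: closed_segment_eq_real_ivl)
    then obtain u where u: "0 \<le> u" "u \<le> 1" "t = (1 - u) * s + u * r"
      by (auto simp: closed_segment_def)
    let ?z = "(1 - u) *\<^sub>R z1 + u *\<^sub>R z2"
    have "?z \<in> zon v c A"
      using convexD_alt[OF convex_zon[OF assms(1)] z(1,3) u(1,2)] .
    moreover have "x + t *\<^sub>R v a - ?z
        = (1 - u) *\<^sub>R (x + s *\<^sub>R v a - z1) + u *\<^sub>R (x + r *\<^sub>R v a - z2)"
      by (simp add: u(3) algebra_simps)
    then have "x + t *\<^sub>R v a - ?z \<in> ?W"
      using span_add[OF span_scale[OF z(2)] span_scale[OF z(4)]] by metis
    ultimately show ?thesis by (auto simp: T_def)
  qed
  define b where "b = Sup ?T"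
  have b: "b \<in> ?T" unfolding b_def by (rule closed_contains_Sup) fact+
  have ub: "t \<le> b" if "t \<in> ?T" for t unfolding b_def using that bdd by (rule cSup_upper)
  have T': "T (insert a A) = {t + u | t u. t \<in> ?T \<and> 0 \<le> u \<and> u \<le> c}"
  proof (intro equalityI subsetI)
    fix t assume "t \<in> T (insert a A)"
    then obtain z u where z: "z \<in> zon v c A" "0 \<le> u" "u \<le> c" "x + t *\<^sub>R v a - (z + u *\<^sub>R v a) \<in> ?W"
      unfolding T_def zon_insert[OF assms(1,2)] by auto
    then have "x + (t - u) *\<^sub>R v a - z \<in> ?W" by (simp add: algebra_simps)
    with z have "t - u \<in> ?T" by (auto simp: T_def)
    with z show "t \<in> {t + u | t u. t \<in> ?T \<and> 0 \<le> u \<and> u \<le> c}"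
      by (intro CollectI exI[of _ "t - u"] exI[of _ u]) auto
  next
    fix t assume "t \<in> {t + u | t u. t \<in> ?T \<and> 0 \<le> u \<and> u \<le> c}"
    then obtain s u z where s: "t = s + u" "0 \<le> u" "u \<le> c" "z \<in> zon v c A" "x + s *\<^sub>R v a - z \<in> ?W"
      by (auto simp: T_def)
    then have "z + u *\<^sub>R v a \<in> zon v c (insert a A)"
      unfolding zon_insert[OF assms(1,2)] by (intro image_eqI[of _ _ "(z, u)"]) auto
    moreover have "x + t *\<^sub>R v a - (z + u *\<^sub>R v a) \<in> ?W" using s by (simp add: algebra_simps)
    ultimately show "t \<in> T (insert a A)" by (auto simp: T_def)
  qed
  have "T (insert a A) - ?T = {b<..b + c}"
  proof (intro equalityI subsetI)
    fix t assume t: "t \<in> T (insert a A) - ?T"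
    then obtain s u where s: "s \<in> ?T" "t = s + u" "0 \<le> u" "u \<le> c" unfolding T' by auto
    have "b < t"
      using conv[OF s(1) b, of t] t s(2,3) by fastforce
    then show "t \<in> {b<..b + c}" using ub[OF s(1)] s by auto
  next
    fix t assume t: "t \<in> {b<..b + c}"
    then have "t \<in> T (insert a A)"
      unfolding T' using b by (intro CollectI exI[of _ b] exI[of _ "t - b"]) auto
    then show "t \<in> T (insert a A) - ?T" using ub t by fastforce
  qed
  then show ?thesis by blast
qed

text \<open>The new cosets are sorted by the line in direction \<open>v a\<close> on which they lie.
  A line is a point of the quotient by the larger span, which accounts for the contracted count, and
  each line gains one window of length k.\<close>

lemma zon_cosets_insert:
  fixes v :: "'i \<Rightarrow> real ^ 'n"
  assumes "finite A" "a \<notin> A" "v a \<notin> span (v ` B)" "v a \<in> lattice" "v ` B \<subseteq> lattice" "finite B"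
    and fin: "finite (zon_cosets v k B A)" "finite (zon_cosets v k (insert a B) A)"
  shows "finite (zon_cosets v (real k) B (insert a A))"
    and "card (zon_cosets v k B (insert a A)) = card (zon_cosets v k B A)
      + k * card (steps v B a \<inter> {0..<1}) * card (zon_cosets v k (insert a B) A)"
proof -
  let ?W = "span (v ` B)" and ?W' = "span (v ` insert a B)" and ?D = "steps v B a"
  let ?P = "zon_cosets v k B (insert a A)" and ?Q = "zon_cosets v k B A"
  let ?R = "zon_cosets v k (insert a B) A"
  have WW': "w \<in> ?W'" if "w \<in> ?W" for w
    using that span_mono[of "v ` B" "v ` insert a B"] by auto
  have va: "t *\<^sub>R v a \<in> ?W'" for t by (intro span_scale span_base) simp
  \<comment> \<open>The representative is taken in the lattice itself, so that
    \<open>\<xi> \<rho> + t *\<^sub>R v a\<close> lies in \<open>mod_span v B\<close> exactly for t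
    in \<open>?D\<close>. A representative from \<open>mod_span v (insert a B)\<close> might be
    displaced along \<open>v a\<close>.\<close>
  have "\<exists>x. x \<in> lattice \<and> \<rho> = coset ?W' x \<and> (\<exists>z\<in>zon v k A. x - z \<in> ?W')"
    if \<rho>: "\<rho> \<in> ?R" for \<rho>
  proof -
    obtain x z where x: "\<rho> = coset ?W' x" "x \<in> mod_span v (insert a B)" "z \<in> zon v k A" "x - z \<in> ?W'"
      using \<rho> unfolding zon_cosets_def by blast
    obtain l w where l: "x = l + w" "l \<in> lattice" "w \<in> ?W'" using x(2) by (auto simp: mod_span_def)
    have "coset ?W' l = \<rho>"
      unfolding x(1) coset_eq_iff[OF subspace_span] using span_neg[OF l(3)] by (simp add: l(1))
    moreover have "l - z = (x - z) - w" by (simp add: l(1))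
    then have "l - z \<in> ?W'" using span_diff[OF x(4) l(3)] by metis
    ultimately show ?thesis using x(3) l(2) by metis
  qed
  then obtain \<xi> where \<xi>: "\<And>\<rho>. \<rho> \<in> ?R \<Longrightarrow> \<xi> \<rho> \<in> lattice" "\<And>\<rho>. \<rho> \<in> ?R \<Longrightarrow> \<rho> = coset ?W' (\<xi> \<rho>)"
      "\<And>\<rho>. \<rho> \<in> ?R \<Longrightarrow> \<exists>z\<in>zon v k A. \<xi> \<rho> - z \<in> ?W'"
    by metis
  define T where "T \<rho> A = {t. \<exists>z\<in>zon v k A. \<xi> \<rho> + t *\<^sub>R v a - z \<in> ?W}" for \<rho> A
  have "\<exists>b. T \<rho> (insert a A) - T \<rho> A = {b<..b + real k}" if "\<rho> \<in> ?R" for \<rho>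
    unfolding T_def
    by (rule line_through_zonotope[OF assms(1-3) _ \<xi>(3)[OF that]]) simp
  then obtain \<beta> where \<beta>: "\<And>\<rho>. \<rho> \<in> ?R \<Longrightarrow> T \<rho> (insert a A) - T \<rho> A = {\<beta> \<rho><..\<beta> \<rho> + real k}"
    by metis
  let ?S = "SIGMA \<rho>:?R. ?D \<inter> {\<beta> \<rho><..\<beta> \<rho> + real k}"
  let ?\<Phi> = "\<lambda>(\<rho>, t). coset ?W (\<xi> \<rho> + t *\<^sub>R v a)"
  have mem_T: "t \<in> T \<rho> A'" if "coset ?W x = coset ?W (\<xi> \<rho> + t *\<^sub>R v a)" "z \<in> zon v k A'" "x - z \<in> ?W"
    for x z t \<rho> A'
  proof -
    have "x - (\<xi> \<rho> + t *\<^sub>R v a) \<in> ?W" using that(1) by (simp add: coset_eq_iff)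
    from span_diff[OF that(3) this] have "\<xi> \<rho> + t *\<^sub>R v a - z \<in> ?W" by simp
    with that(2) show ?thesis by (auto simp: T_def)
  qed
  have bij: "bij_betw ?\<Phi> ?S (?P - ?Q)"
  proof (rule bij_betw_imageI)
    show "inj_on ?\<Phi> ?S"
    proof (rule inj_onI)
      fix p q assume p: "p \<in> ?S" and q: "q \<in> ?S" and eq: "?\<Phi> p = ?\<Phi> q"
      obtain \<rho> s \<sigma> t where pq: "p = (\<rho>, s)" "q = (\<sigma>, t)" by fastforce
      then have R: "\<rho> \<in> ?R" "\<sigma> \<in> ?R" using p q by auto
      have d: "\<xi> \<rho> + s *\<^sub>R v a - (\<xi> \<sigma> + t *\<^sub>R v a) \<in> ?W"
        using eq by (simp add: pq coset_eq_iff)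
      have "\<xi> \<rho> - \<xi> \<sigma> = (\<xi> \<rho> + s *\<^sub>R v a - (\<xi> \<sigma> + t *\<^sub>R v a)) + (t - s) *\<^sub>R v a"
        by (simp add: algebra_simps)
      also have "\<dots> \<in> ?W'" by (rule span_add[OF WW'[OF d] va])
      finally have "\<rho> = \<sigma>"
        using \<xi>(2)[OF R(1)] \<xi>(2)[OF R(2)] coset_eq_iff[OF subspace_span] by metis
      with d have "(s - t) *\<^sub>R v a \<in> ?W" by (simp add: algebra_simps)
      then have "s = t"
        using span_scale[of "(s - t) *\<^sub>R v a" "v ` B" "inverse (s - t)"] assms(3) by (cases "s = t") auto
      with \<open>\<rho> = \<sigma>\<close> show "p = q" by (simp add: pq)
    qed
    show "?\<Phi> ` ?S = ?P - ?Q"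
    proof (intro equalityI subsetI)
      fix p assume "p \<in> ?\<Phi> ` ?S"
      then obtain \<rho> t where p: "p = coset ?W (\<xi> \<rho> + t *\<^sub>R v a)" "\<rho> \<in> ?R" "t \<in> ?D"
          "t \<in> T \<rho> (insert a A)" "t \<notin> T \<rho> A" using \<beta> by fastforce
      have "\<xi> \<rho> + t *\<^sub>R v a \<in> mod_span v B"
        using p(3) lattice_subset_mod_span[OF \<xi>(1)[OF p(2)]]
        by (intro mod_span_add) (simp_all add: steps_def)
      then have "p \<in> ?P"
        using p(1,4) unfolding zon_cosets_def T_def by blast
      moreover have "p \<notin> ?Q"
      proof
        assume "p \<in> ?Q"
        then obtain x z where "p = coset ?W x" "z \<in> zon v k A" "x - z \<in> ?W"
          by (auto simp: zon_cosets_def)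
        with mem_T[of x \<rho> t z A] p(1,5) show False by simp
      qed
      ultimately show "p \<in> ?P - ?Q" by blast
    next
      fix p assume p: "p \<in> ?P - ?Q"
      then obtain x z' where x: "p = coset ?W x" "x \<in> mod_span v B" "z' \<in> zon v k (insert a A)" "x - z' \<in> ?W"
        by (auto simp: zon_cosets_def)
      then obtain z u where z: "z \<in> zon v k A" "z' = z + u *\<^sub>R v a"
        unfolding zon_insert[OF assms(1,2)] by auto
      define \<rho> where "\<rho> = coset ?W' x"
      have "x - z = (x - z') + u *\<^sub>R v a" by (simp add: z)
      also have "\<dots> \<in> ?W'" by (rule span_add[OF WW'[OF x(4)] va])
      finally have "x - z \<in> ?W'" .
      moreover have "x \<in> mod_span v (insert a B)"
        using x(2) WW' unfolding mod_span_def by blast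
      ultimately have R: "\<rho> \<in> ?R" using z(1) unfolding zon_cosets_def \<rho>_def by blast
      have "x - \<xi> \<rho> \<in> ?W'"
        using \<xi>(2)[OF R] unfolding \<rho>_def by (metis coset_eq_iff subspace_span)
      then obtain w t where w: "w \<in> ?W" "x - \<xi> \<rho> = w + t *\<^sub>R v a" by (rule span_image_insert)
      then have xe: "x - (\<xi> \<rho> + t *\<^sub>R v a) = w" by (simp add: algebra_simps)
      have pe: "p = coset ?W (\<xi> \<rho> + t *\<^sub>R v a)"
        unfolding x(1) using w(1) xe by (subst coset_eq_iff) (auto simp: subspace_span)
      have "t *\<^sub>R v a = (x - \<xi> \<rho>) - w" using w(2) by simp
      also have "\<dots> \<in> mod_span v B"
        by (intro mod_span_diff x(2) lattice_subset_mod_span span_subset_mod_span w \<xi> R)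
      finally have "t \<in> ?D" by (simp add: steps_def)
      moreover have "t \<in> T \<rho> (insert a A)"
        using mem_T[OF _ x(3,4)] pe x(1) by simp
      moreover have "t \<notin> T \<rho> A"
      proof
        assume "t \<in> T \<rho> A"
        then obtain y where y: "y \<in> zon v k A" "\<xi> \<rho> + t *\<^sub>R v a - y \<in> ?W" by (auto simp: T_def)
        have "x - y \<in> ?W" using span_add[OF w(1) y(2)] xe by (simp add: algebra_simps)
        then have "p \<in> ?Q" using x(1,2) y(1) unfolding zon_cosets_def by blast
        with p show False by blast
      qed
      ultimately have "(\<rho>, t) \<in> ?S" using R \<beta>[OF R] by blast
      then show "p \<in> ?\<Phi> ` ?S" using pe by (intro image_eqI[of _ _ "(\<rho>, t)"]) auto
    qed
  qed
  have D: "\<forall>s\<in>?D. \<forall>t\<in>?D. s - t \<in> ?D" "\<forall>k. of_int k \<in> ?D"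
    by (simp_all add: steps_diff of_int_in_steps assms(4))
  have win: "bij_betw (\<lambda>(r, q). r + of_int (\<lfloor>b - r\<rfloor> + 1 + int q)) ((?D \<inter> {0..<1}) \<times> {..<k})
      (?D \<inter> {b<..b + real k})" for b
    by (rule bij_betw_subgroup_window[OF D])
  have finD: "finite (?D \<inter> {0..<1})" by (rule finite_steps_window) fact+
  have finwin: "finite (?D \<inter> {b<..b + real k})" for b
    using bij_betw_finite[OF win[of b]] finD by simp
  have cardwin: "card (?D \<inter> {b<..b + real k}) = card (?D \<inter> {0..<1}) * k" for b
    using bij_betw_same_card[OF win[of b]] by (simp only: card_cartesian_product card_lessThan)
  have finS: "finite ?S" using fin(2) finwin by (intro finite_SigmaI)
  have finPQ: "finite (?P - ?Q)" using bij_betw_finite[OF bij] finS by simp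
  have "card (?P - ?Q) = card ?S" using bij_betw_same_card[OF bij] by simp
  have "?P \<subseteq> (?P - ?Q) \<union> ?Q" by blast
  then show "finite ?P" by (rule finite_subset) (use finPQ fin in simp)
  have "?Q \<subseteq> ?P"
  proof
    fix p assume "p \<in> ?Q"
    then obtain x z where x: "p = coset ?W x" "x \<in> mod_span v B" "z \<in> zon v k A" "x - z \<in> ?W"
      by (auto simp: zon_cosets_def)
    have "z \<in> zon v k (insert a A)"
      unfolding zon_insert[OF assms(1,2)] using x(3) by (intro image_eqI[of _ _ "(z, 0)"]) auto
    with x show "p \<in> ?P" unfolding zon_cosets_def by blast
  qed
  then have "card ?P = card ?Q + card (?P - ?Q)"
    using fin(1) finPQ by (subst card_Un_disjoint[symmetric]) (auto simp: Un_absorb1)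
  also have "card (?P - ?Q) = card ?S" by fact
  also have "card ?S = (\<Sum>\<rho>\<in>?R. card (?D \<inter> {0..<1}) * k)"
    using fin(2) finwin by (simp add: cardwin)
  also have "\<dots> = k * card (?D \<inter> {0..<1}) * card ?R" by simp
  finally show "card ?P = card ?Q + k * card (?D \<inter> {0..<1}) * card ?R" .
qed

text \<open>\<open>B\<close> is generalised because contraction moves generators from
  \<open>A\<close> into it. Subsets without \<open>a\<close> come from the deleted count, subsets
  with \<open>a\<close> from the contracted one.\<close>

lemma card_zon_cosets:
  fixes v :: "'i \<Rightarrow> real ^ 'n"
  assumes "finite A" "finite B" "A \<inter> B = {}" "v ` (A \<union> B) \<subseteq> lattice"
  shows "finite (zon_cosets v (real k) B A) \<and>
    card (zon_cosets v k B A) = (\<Sum>S\<in>Pow A. k ^ card S * card (frac_pts v B S))"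
  using assms
proof (induction A arbitrary: B rule: finite_induct)
  case empty
  have "zon_cosets v k B {} = {coset (span (v ` B)) 0}"
  proof (intro equalityI subsetI)
    fix p assume "p \<in> zon_cosets v k B {}"
    then obtain x where "p = coset (span (v ` B)) x" "x \<in> span (v ` B)"
      by (auto simp: zon_cosets_def)
    then show "p \<in> {coset (span (v ` B)) 0}"
      using coset_eq_iff[OF subspace_span, of "v ` B" x 0] by simp
  qed (auto simp: zon_cosets_def span_zero intro!: exI[of _ 0] lattice_subset_mod_span zero_in_lattice)
  moreover have "frac_pts v B {} = {\<lambda>_. undefined}"
    by (auto simp: frac_pts_def intro!: lattice_subset_mod_span zero_in_lattice)
  ultimately show ?case by simp
next
  case (insert a A)
  let ?d = "card (steps v B a \<inter> {0..<1})"
  have a: "v a \<in> lattice" using insert.prems by auto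
  have IH: "finite (zon_cosets v (real k) B A)"
    "card (zon_cosets v k B A) = (\<Sum>S\<in>Pow A. k ^ card S * card (frac_pts v B S))"
    using insert.IH[of B] insert.prems by auto
  have IH': "finite (zon_cosets v (real k) (insert a B) A)"
    "card (zon_cosets v k (insert a B) A)
      = (\<Sum>S\<in>Pow A. k ^ card S * card (frac_pts v (insert a B) S))"
    using insert.IH[of "insert a B"] insert.prems insert.hyps by auto
  have main: "finite (zon_cosets v (real k) B (insert a A)) \<and>
    card (zon_cosets v k B (insert a A)) = card (zon_cosets v k B A) + k * ?d * card (zon_cosets v k (insert a B) A)"
  proof (cases "v a \<in> span (v ` B)")
    case True
    \<comment> \<open>The infinite window has \<open>card\<close> 0, which is the right factor: a
      generator inside the span adds no coset.\<close>
    then have "steps v B a = UNIV"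
      by (auto simp: steps_def intro: span_subset_mod_span span_scale)
    then have "?d = 0" by (simp add: infinite_Ico)
    with True IH(1) show ?thesis
      using zon_cosets_insert_in_span[OF insert.hyps True, of "real k"] by simp
  next
    case False
    show ?thesis
      using zon_cosets_insert[OF insert.hyps False a _ insert.prems(1) IH(1) IH'(1)] insert.prems by auto
  qed
  have pw: "Pow (insert a A) = Pow A \<union> insert a ` Pow A" by (rule Pow_insert)
  have "(\<Sum>S\<in>Pow (insert a A). k ^ card S * card (frac_pts v B S))
    = (\<Sum>S\<in>Pow A. k ^ card S * card (frac_pts v B S))
      + (\<Sum>S\<in>insert a ` Pow A. k ^ card S * card (frac_pts v B S))"
    unfolding pw using insert.hyps by (intro sum.union_disjoint) auto
  also have "(\<Sum>S\<in>insert a ` Pow A. k ^ card S * card (frac_pts v B S))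
    = (\<Sum>S\<in>Pow A. k ^ card (insert a S) * card (frac_pts v B (insert a S)))"
    using insert.hyps by (intro sum.reindex[unfolded o_def]) (auto simp: inj_on_def)
  also have "\<dots> = (\<Sum>S\<in>Pow A. k * ?d * (k ^ card S * card (frac_pts v (insert a B) S)))"
  proof (rule sum.cong[OF refl])
    fix S assume "S \<in> Pow A"
    then have S: "finite S" "a \<notin> S" using insert.hyps finite_subset by auto
    show "k ^ card (insert a S) * card (frac_pts v B (insert a S))
        = k * ?d * (k ^ card S * card (frac_pts v (insert a B) S))"
      using S by (simp add: card_frac_pts_insert[where v = v, OF S a])
  qed
  also have "\<dots> = k * ?d * card (zon_cosets v k (insert a B) A)"
    by (simp add: IH'(2) sum_distrib_left)
  finally show ?case using main IH(2) by simp
qed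

section \<open>The Ehrhart polynomial of a zonotope\<close>

lemma ehrhart_coeff_zonotope:
  fixes v :: "nat \<Rightarrow> real ^ 'n"
  assumes "\<forall>k<m. v k \<in> lattice"
  shows "ehrhart_coeff i (zonotope v m) =
    (\<Sum>S | S \<subseteq> {..<m} \<and> card S = i. real (card (frac_pts v {} S)))"
proof -
  define p :: "real poly" where
    "p = (\<Sum>S\<in>Pow {..<m}. monom (real (card (frac_pts v {} S))) (card S))"
  have count: "lattice_count (zonotope v m) k = card (zon_cosets v (real k) {} {..<m})" for k
  proof -
    have "zon v (real k) {..<m} = (*\<^sub>R) (real k) ` zonotope v m"
    proof (intro equalityI subsetI)
      fix x assume "x \<in> zon v (real k) {..<m}"
      then obtain t where t: "\<forall>i<m. 0 \<le> t i \<and> t i \<le> real k" "x = (\<Sum>i<m. t i *\<^sub>R v i)"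
        by (auto simp: zon_def)
      have "t i = real k * (t i / real k)" if "i < m" for i using t(1) that by (cases "k = 0") auto
      then have "x = real k *\<^sub>R (\<Sum>i<m. (t i / real k) *\<^sub>R v i)"
        unfolding t(2) scaleR_sum_right by (intro sum.cong) auto
      moreover have "(\<Sum>i<m. (t i / real k) *\<^sub>R v i) \<in> zonotope v m"
        unfolding zonotope_def using t(1)
        by (intro CollectI exI[of _ "\<lambda>i. t i / real k"]) (auto simp: divide_le_eq)
      ultimately show "x \<in> (*\<^sub>R) (real k) ` zonotope v m" by blast
    next
      fix x assume "x \<in> (*\<^sub>R) (real k) ` zonotope v m"
      then obtain t where t: "\<forall>i<m. 0 \<le> t i \<and> t i \<le> 1" "x = real k *\<^sub>R (\<Sum>i<m. t i *\<^sub>R v i)"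
        by (auto simp: zonotope_def)
      then show "x \<in> zon v (real k) {..<m}"
        unfolding zon_def
        by (intro CollectI exI[of _ "\<lambda>i. real k * t i"])
          (auto simp: scaleR_sum_right mult_left_le)
    qed
    moreover have "coset {0} x = {x}" for x :: "real ^ 'n" by (auto simp: coset_def)
    ultimately have "zon_cosets v (real k) {} {..<m}
        = (\<lambda>x. {x}) ` (((*\<^sub>R) (real k) ` zonotope v m) \<inter> lattice)"
      by (auto simp: zon_cosets_def mod_span_def)
    then show ?thesis
      by (simp add: lattice_count_def card_image)
  qed
  have p: "poly p (real k) = real (lattice_count (zonotope v m) k)" for k
  proof -
    have "card (zon_cosets v (real k) {} {..<m})
        = (\<Sum>S\<in>Pow {..<m}. k ^ card S * card (frac_pts v {} S))"
      using card_zon_cosets[of "{..<m}" "{}" v k] assms by auto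
    then show ?thesis
      by (simp add: count p_def poly_sum poly_monom mult.commute)
  qed
  have "ehrhart_poly (zonotope v m) = p"
    unfolding ehrhart_poly_def
  proof (rule the_equality)
    fix q :: "real poly" assume q: "\<forall>k. poly q (real k) = real (lattice_count (zonotope v m) k)"
    have "range real \<subseteq> {x. poly (q - p) x = 0}" using p q by auto
    moreover have "infinite (range real)" by (simp add: finite_image_iff inj_of_nat)
    ultimately have "infinite {x. poly (q - p) x = 0}" using finite_subset by blast
    then show "q = p" using poly_roots_finite[of "q - p"] by auto
  qed (use p in simp)
  then have "ehrhart_coeff i (zonotope v m)
      = (\<Sum>S\<in>Pow {..<m}. if card S = i then real (card (frac_pts v {} S)) else 0)"
    by (simp add: ehrhart_coeff_def p_def coeff_sum)
  also have "\<dots> = (\<Sum>S | S \<subseteq> {..<m} \<and> card S = i. real (card (frac_pts v {} S)))"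
    by (simp add: sum.If_cases Pow_def Collect_conj_eq)
  finally show ?thesis .
qed

section \<open>Packing modulo a lattice\<close>

definition unit_box :: "(real ^ 'n) set" where
  "unit_box = {x. \<forall>j. 0 \<le> x $ j \<and> x $ j < 1}"

text \<open>Convexity serves as the source of Lebesgue measurability, through
  \<open>measurable_convex\<close>.\<close>

lemma convex_half_open_box:
  fixes l u :: "real ^ 'n"
  shows "convex {y. \<forall>j. l $ j \<le> y $ j \<and> y $ j < u $ j + s $ j}"
proof (rule convexI)
  fix x y :: "real ^ 'n" and p q :: real
  assume x: "x \<in> {y. \<forall>j. l $ j \<le> y $ j \<and> y $ j < u $ j + s $ j}"
    and y: "y \<in> {y. \<forall>j. l $ j \<le> y $ j \<and> y $ j < u $ j + s $ j}"
    and p: "0 \<le> p" "0 \<le> q" "p + q = 1"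
  have "l $ j \<le> p * x $ j + q * y $ j" for j
    using convex_bound_le[of "- x $ j" "- l $ j" "- y $ j" p q] x y p by simp
  moreover have "p * x $ j + q * y $ j < u $ j + s $ j" for j
    using convex_bound_lt[of "x $ j" "u $ j + s $ j" "y $ j" p q] x y p by simp
  ultimately show "p *\<^sub>R x + q *\<^sub>R y \<in> {y. \<forall>j. l $ j \<le> y $ j \<and> y $ j < u $ j + s $ j}"
    by simp
qed

lemma measure_half_open_box:
  fixes l s :: "real ^ 'n"
  assumes "\<And>j. 0 < s $ j"
  defines "H \<equiv> {y. \<forall>j. l $ j \<le> y $ j \<and> y $ j < l $ j + s $ j}"
  shows "bounded H" "H \<in> lmeasurable" "measure lebesgue H = (\<Prod>j\<in>UNIV. s $ j)"
proof -
  have sub: "box l (l + s) \<subseteq> H" "H \<subseteq> cbox l (l + s)"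
    by (auto simp: H_def mem_box_cart less_imp_le)
  have "convex H" unfolding H_def by (rule convex_half_open_box)
  moreover show bdd: "bounded H" using bounded_subset[OF bounded_cbox sub(2)] .
  ultimately show H: "H \<in> lmeasurable" by (rule measurable_convex)
  have ne: "cbox l (l + s) \<noteq> {}"
    using assms(1) by (auto simp: interval_ne_empty_cart less_imp_le)
  have c: "measure lebesgue (cbox l (l + s)) = (\<Prod>j\<in>UNIV. s $ j)"
    using content_cbox_cart[OF ne] by simp
  have b: "measure lebesgue (box l (l + s)) = measure lebesgue (cbox l (l + s))"
    by (simp add: measure_lborel_box_eq measure_lborel_cbox_eq)
  show "measure lebesgue H = (\<Prod>j\<in>UNIV. s $ j)"
    using measure_mono_fmeasurable[OF sub(1) _ H] measure_mono_fmeasurable[OF sub(2) _ lmeasurable_cbox] H b c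
    by (auto simp: fmeasurableD)
qed

lemma unit_box_alt: "unit_box = {y. \<forall>j. (0::real^'n) $ j \<le> y $ j \<and> y $ j < (0::real^'n) $ j + (1::real^'n) $ j}"
  by (simp add: unit_box_def)

lemma bounded_unit_box: "bounded (unit_box :: (real ^ 'n) set)"
proof (rule bounded_subset[OF bounded_cbox[of 0 1]])
  show "(unit_box :: (real ^ 'n) set) \<subseteq> cbox 0 1"
    by (auto simp: unit_box_def mem_box_cart less_imp_le)
qed

lemma convex_unit_box: "convex (unit_box :: (real ^ 'n) set)"
  unfolding unit_box_alt by (rule convex_half_open_box)

lemma unit_box_unique:
  assumes "x - u \<in> unit_box" "x - u' \<in> unit_box" "u \<in> lattice" "u' \<in> lattice"
  shows "u = u'"
proof (rule vec_eq_iff[THEN iffD2], rule allI)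
  fix j
  obtain a b :: int where ab: "u $ j = of_int a" "u' $ j = of_int b"
    using assms(3,4) by (auto simp: lattice_def elim!: Ints_cases) (metis Ints_cases)
  have "\<bar>real_of_int a - of_int b\<bar> < 1"
    using assms(1,2)[unfolded unit_box_def mem_Collect_eq, THEN spec, of j] ab by auto
  then have "a = b" by linarith
  then show "u $ j = u' $ j" by (simp add: ab)
qed

text \<open>Points of \<open>X\<close> represent distinct classes of \<open>L\<close> modulo the
  integer lattice, and no two points of \<open>E\<close>, seen through \<open>T\<close>, are
  congruent modulo \<open>L\<close>. Hence the translates of \<open>E\<close> by \<open>X\<close>
  stay disjoint when they are cut up and moved by integer vectors into one fundamental cell, the
  unit box. Both volumes are taken in the \<open>Y\<close> coordinates, so the determinant of
  \<open>Y\<close> never enters.\<close>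

lemma packing_bound:
  fixes Y T :: "real ^ 'n \<Rightarrow> real ^ 'n"
  assumes Y: "linear Y" "\<And>x. T (Y x) = x" "\<And>y. Y (T y) = y"
    and L: "\<And>x y. x \<in> L \<Longrightarrow> y \<in> L \<Longrightarrow> x - y \<in> L" "lattice \<subseteq> L"
    and E: "E \<in> lmeasurable" "bounded E" "\<And>x y. x \<in> E \<Longrightarrow> y \<in> E \<Longrightarrow> T (x - y) \<in> L \<Longrightarrow> x = y"
    and X: "finite X" "X \<subseteq> L \<inter> unit_box"
  shows "card X * measure lebesgue E \<le> measure lebesgue (Y ` unit_box)"
proof -
  interpret Y: linear Y by fact
  have T: "linear T"
    using linear_inverse_left[OF Y(1)] Y by (metis (no_types, opaque_lifting) linear_iff Y.add Y.scale)
  interpret T: linear T by fact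
  let ?C = "Y ` unit_box"
  have Cm: "?C \<in> lmeasurable"
    by (intro measurable_convex convex_linear_image bounded_linear_image convex_unit_box
        bounded_unit_box Y(1) linear_conv_bounded_linear[THEN iffD1])
  define fl :: "real ^ 'n \<Rightarrow> real ^ 'n" where "fl x = (\<chi> j. of_int \<lfloor>x $ j\<rfloor>)" for x :: "real ^ 'n"
  have fl: "fl x \<in> lattice" "x - fl x \<in> unit_box" for x
    by (auto simp: fl_def lattice_def unit_box_def of_int_floor_le
        frac_def[symmetric] frac_lt_1)
  have TE: "bounded (T ` E)"
    using bounded_linear_image[OF E(2)] T by (simp add: linear_conv_bounded_linear)
  have "bounded ((\<lambda>(x, y). x + y) ` (T ` E \<times> X))"
    using bounded_plus[OF TE finite_imp_bounded[OF X(1)]] .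
  then have "bounded ((\<lambda>(x, y). x - y) ` ((\<lambda>(x, y). x + y) ` (T ` E \<times> X) \<times> unit_box))"
    by (rule bounded_minus[OF _ bounded_unit_box])
  \<comment> \<open>Only integer vectors of this bounded set can move a point of a translate into
    the unit box, so finite additivity of the measure is enough.\<close>
  then have U: "finite (lattice \<inter> (\<lambda>(x, y). x - y) ` ((\<lambda>(x, y). x + y) ` (T ` E \<times> X) \<times> unit_box))"
      (is "finite ?U") by (rule finite_lattice_bounded)
  define piece where "piece = (\<lambda>(g, u). E \<inter> (+) (- Y (g - u)) ` ?C)"
  have piece_iff: "e \<in> piece (g, u) \<longleftrightarrow> e \<in> E \<and> T e + g - u \<in> unit_box" for e g u
  proof -
    have "e \<in> (+) (- Y (g - u)) ` ?C \<longleftrightarrow> e + Y (g - u) \<in> ?C"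
      by (auto simp: image_iff algebra_simps)
    also have "e + Y (g - u) = Y (T e + g - u)" by (simp add: Y.add Y.diff Y(3))
    also have "Y (T e + g - u) \<in> ?C \<longleftrightarrow> T e + g - u \<in> unit_box"
      by (metis Y(2) image_iff)
    finally show ?thesis by (auto simp: piece_def)
  qed
  have pm: "piece p \<in> lmeasurable" for p
    by (cases p) (auto simp: piece_def intro!: fmeasurable.Int E measurable_translation_subtract Cm)
  define P where "P = (\<lambda>(g, u). (+) (Y (g - u)) ` piece (g, u))"
  have Pm: "P p \<in> lmeasurable" for p
    by (cases p) (auto simp: P_def intro!: measurable_translation pm)
  have Pe: "measure lebesgue (P p) = measure lebesgue (piece p)" for p
    by (cases p) (simp add: P_def measure_translation)
  have E_eq: "measure lebesgue E = (\<Sum>u\<in>?U. measure lebesgue (piece (g, u)))" if g: "g \<in> X" for g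
  proof -
    have "E = (\<Union>u\<in>?U. piece (g, u))"
    proof (intro equalityI subsetI)
      fix e assume e: "e \<in> E"
      have "T e + g \<in> (\<lambda>(x, y). x + y) ` (T ` E \<times> X)"
        using e g by (intro image_eqI[of _ _ "(T e, g)"]) auto
      then have "fl (T e + g) \<in> ?U"
        using fl[of "T e + g"]
          image_eqI[of "fl (T e + g)" "\<lambda>(x, y). x - y" "(T e + g, T e + g - fl (T e + g))"]
        by simp
      moreover have "e \<in> piece (g, fl (T e + g))"
        using e fl[of "T e + g"] by (simp add: piece_iff)
      ultimately show "e \<in> (\<Union>u\<in>?U. piece (g, u))" by blast
    qed (auto simp: piece_iff)
    moreover have "pairwise (\<lambda>u u'. disjnt (piece (g, u)) (piece (g, u'))) ?U"
    proof (rule pairwiseI)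
      fix u u' assume u: "u \<in> ?U" "u' \<in> ?U" "u \<noteq> u'"
      show "disjnt (piece (g, u)) (piece (g, u'))"
        unfolding disjnt_iff
      proof (intro allI notI)
        fix e assume "e \<in> piece (g, u) \<and> e \<in> piece (g, u')"
        then have "T e + g - u \<in> unit_box" "T e + g - u' \<in> unit_box" by (auto simp: piece_iff)
        moreover have "u \<in> lattice" "u' \<in> lattice" using u by auto
        ultimately have "u = u'" by (rule unit_box_unique)
        with u show False by simp
      qed
    qed
    ultimately show ?thesis
      using measure_UNION'[of ?U "\<lambda>u. piece (g, u)" lebesgue] U pm by simp
  qed
  have "card X * measure lebesgue E = (\<Sum>g\<in>X. measure lebesgue E)" by simp
  also have "\<dots> = (\<Sum>g\<in>X. \<Sum>u\<in>?U. measure lebesgue (piece (g, u)))"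
    by (rule sum.cong[OF refl E_eq])
  also have "\<dots> = (\<Sum>p\<in>X \<times> ?U. measure lebesgue (P p))"
    by (simp add: sum.cartesian_product Pe split_def)
  also have "\<dots> = measure lebesgue (\<Union>p\<in>X \<times> ?U. P p)"
  proof (rule measure_UNION'[symmetric])
    show "pairwise (\<lambda>p q. disjnt (P p) (P q)) (X \<times> ?U)"
    proof (rule pairwiseI)
      fix p q assume p: "p \<in> X \<times> ?U" and q: "q \<in> X \<times> ?U" and ne: "p \<noteq> q"
      obtain g u g' u' where pq: "p = (g, u)" "q = (g', u')" by fastforce
      show "disjnt (P p) (P q)"
        unfolding disjnt_iff
      proof (intro allI notI)
        fix y assume "y \<in> P p \<and> y \<in> P q"
        then obtain e e' where e: "e \<in> piece (g, u)" "e' \<in> piece (g', u')"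
            "y = Y (g - u) + e" "y = Y (g' - u') + e'" by (auto simp: P_def pq)
        have L': "g \<in> L" "g' \<in> L" "u \<in> L" "u' \<in> L" using p q X L(2) by (auto simp: pq)
        have "e - e' = Y ((g' - u') - (g - u))" using e(3,4) by (simp add: Y.diff Y.add algebra_simps)
        then have "T (e - e') = (g' - u') - (g - u)" by (simp add: Y(2))
        also have "\<dots> \<in> L" by (intro L(1) L')
        finally have ee: "e = e'" using E(3) e(1,2) by (auto simp: piece_iff)
        with e(3,4) have "Y (g - u) = Y (g' - u')" by simp
        then have gu: "g - u = g' - u'" by (metis Y(2))
        have "g \<in> unit_box" "g' \<in> unit_box" using p q X by (auto simp: pq)
        moreover have "u - u' \<in> lattice" using p q by (auto simp: pq lattice_def)
        moreover have "g - (u - u') = g'" using gu by (simp add: algebra_simps)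
        moreover have "0 \<in> lattice" by (simp add: lattice_def)
        ultimately have "u - u' = 0" using unit_box_unique[of g "u - u'" 0] by simp
        with gu ne show False by (simp add: pq)
      qed
    qed
  qed (use U X(1) Pm in auto)
  also have "\<dots> \<le> measure lebesgue ?C"
  proof (rule measure_mono_fmeasurable)
    show "(\<Union>p\<in>X \<times> ?U. P p) \<subseteq> ?C"
    proof clarify
      fix y g u assume "y \<in> P (g, u)"
      then obtain e where "e \<in> piece (g, u)" "y = Y (g - u) + e" by (auto simp: P_def)
      moreover from this have "y = Y (T e + g - u)" by (simp add: Y.add Y.diff Y(3))
      ultimately show "y \<in> ?C" using piece_iff by blast
    qed
    show "(\<Union>p\<in>X \<times> ?U. P p) \<in> sets lebesgue"
      using U X(1) Pm by (intro sets.finite_UN) (auto simp: fmeasurableD)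
  qed fact
  finally show ?thesis by simp
qed

section \<open>Successive minima of the cube\<close>

text \<open>\<open>w\<close> assigns to each coordinate the index of its radius, and
  \<open>short\<close> is the triangular system. \<open>K\<close> may exceed the dimension, because
  restriction to a subset S moves the coordinates outside S to indices beyond the dimension. With
  \<open>t 0 = 0\<close> the increments of \<open>t\<close> telescope.\<close>

locale triangular_minima =
  fixes L :: "(real ^ 'n) set" and w :: "'n \<Rightarrow> nat" and K :: nat and t :: "nat \<Rightarrow> real"
    and a :: "'n \<Rightarrow> 'n \<Rightarrow> real"
  assumes L_diff: "\<And>x y. x \<in> L \<Longrightarrow> y \<in> L \<Longrightarrow> x - y \<in> L"
    and L_lattice: "lattice \<subseteq> L"
    and inj_w: "inj w" and w_range: "\<And>j. w j \<in> {1..K}"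
    and t_0: "t 0 = 0" and t_1: "0 < t 1" and t_mono: "\<And>k. t k \<le> t (Suc k)"
    and short: "\<And>x j. x \<in> L \<Longrightarrow> \<forall>i. \<bar>x $ i\<bar> < t (w j) \<Longrightarrow> x $ j = (\<Sum>i | w i < w j. a j i * x $ i)"
begin

text \<open>Turns the relation in \<open>short\<close> into a vanishing coordinate: a vector of
  \<open>L\<close> that is short for index \<open>w j\<close> has j-th coordinate 0 under
  \<open>Y\<close>.\<close>

definition Y :: "real ^ 'n \<Rightarrow> real ^ 'n" where
  "Y x = (\<chi> j. x $ j - (\<Sum>i | w i < w j. a j i * x $ i))"

lemma linear_Y: "linear Y"
  by (rule linearI)
    (simp_all add: Y_def vec_eq_iff algebra_simps sum.distrib sum_distrib_left)

lemma inj_Y: "inj Y"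
  unfolding linear_injective_0[OF linear_Y]
proof (intro allI impI)
  fix x assume x: "Y x = 0"
  have "x $ j = 0" for j
  proof (induction "w j" arbitrary: j rule: less_induct)
    case less
    then have "(\<Sum>i | w i < w j. a j i * x $ i) = 0" by (intro sum.neutral) auto
    moreover have "Y x $ j = 0" using x by simp
    ultimately show ?case by (simp add: Y_def)
  qed
  then show "x = 0" by (simp add: vec_eq_iff)
qed

definition T :: "real ^ 'n \<Rightarrow> real ^ 'n" where "T = inv Y"

lemma T_Y [simp]: "T (Y x) = x"
  by (simp add: T_def inj_Y)

lemma Y_T [simp]: "Y (T y) = y"
  unfolding T_def by (rule surj_f_inv_f[OF linear_injective_imp_surjective[OF linear_Y inj_Y refl]])

lemma linear_T: "linear T"
proof (rule linearI)
  interpret Y: linear Y by (rule linear_Y)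
  show "T (x + y) = T x + T y" for x y
    by (metis T_Y Y_T Y.add)
  show "T (r *\<^sub>R x) = r *\<^sub>R T x" for r x
    by (metis T_Y Y_T Y.scale)
qed

lemma t_nonneg_diff: "0 \<le> t k - t (k - 1)"
  using t_mono[of "k - 1"] by (cases k) auto

lemma telescope: "(\<Sum>k=1..m. t k - t (k - 1)) = t m"
  by (induction m) (auto simp: t_0)

lemma t_le: "i \<le> j \<Longrightarrow> t i \<le> t j"
  by (rule lift_Suc_mono_le[of t, OF t_mono])

lemma t_pos: "1 \<le> k \<Longrightarrow> 0 < t k"
  using t_le[of 1 k] t_1 by simp

section \<open>A grid version of Minkowski's deformation of the unit box\<close>

definition P :: "real \<Rightarrow> ('n \<Rightarrow> real) \<Rightarrow> real ^ 'n" where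
  "P h c = T (\<chi> j. h * c j)"

text \<open>The whole half-open cell has to fit into the unit box, since \<open>pt\<close> keeps
  some offsets within a selected cell and replaces the others by 0.\<close>

definition cells :: "real \<Rightarrow> ('n \<Rightarrow> int) set" where
  "cells h = {z. \<forall>r. (\<forall>j. 0 \<le> r j \<and> r j < 1) \<longrightarrow> P h (\<lambda>j. of_int (z j) + r j) \<in> unit_box}"

text \<open>The choice depends only on the coordinates \<open>j\<close> of \<open>z\<close> with \<open>k \<le> w j\<close>. It plays the
  role of the centroid of a section of the body in the classical proof of Minkowski's second theorem.\<close>

definition sel :: "real \<Rightarrow> nat \<Rightarrow> ('n \<Rightarrow> int) \<Rightarrow> 'n \<Rightarrow> int" where
  "sel h k z = (SOME z'. z' \<in> cells h \<and> (\<forall>j. k \<le> w j \<longrightarrow> z' j = z j))"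

lemma sel:
  assumes "z \<in> cells h"
  shows "sel h k z \<in> cells h" "\<And>j. k \<le> w j \<Longrightarrow> sel h k z j = z j"
proof -
  have "sel h k z \<in> cells h \<and> (\<forall>j. k \<le> w j \<longrightarrow> sel h k z j = z j)"
    unfolding sel_def by (rule someI[of _ z]) (use assms in simp)
  then show "sel h k z \<in> cells h" "\<And>j. k \<le> w j \<Longrightarrow> sel h k z j = z j" by auto
qed

lemma sel_cong:
  assumes "\<And>j. k \<le> w j \<Longrightarrow> z j = z' j"
  shows "sel h k z = sel h k z'"
proof -
  have "(\<lambda>y. y \<in> cells h \<and> (\<forall>j. k \<le> w j \<longrightarrow> y j = z j))
      = (\<lambda>y. y \<in> cells h \<and> (\<forall>j. k \<le> w j \<longrightarrow> y j = z' j))"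
    using assms by (intro ext) auto
  then show ?thesis by (simp add: sel_def)
qed

text \<open>For z in \<open>cells h\<close>, this point has the \<open>Y\<close> coordinates of the
  original one at every j with \<open>k \<le> w j\<close>, and the remaining ones are functions of
  the integer parts of these. Zero offsets below index k prevent any dependence on the lower
  coordinates.\<close>

definition pt :: "real \<Rightarrow> nat \<Rightarrow> ('n \<Rightarrow> int) \<Rightarrow> ('n \<Rightarrow> real) \<Rightarrow> real ^ 'n" where
  "pt h k z r = P h (\<lambda>j. of_int (sel h k z j) + (if k \<le> w j then r j else 0))"

text \<open>In the coordinates \<open>Y\<close> this map scales coordinate \<open>j\<close> by \<open>t (w j)\<close> and translates it by
  a function of the later coordinates.\<close>

definition img :: "real \<Rightarrow> ('n \<Rightarrow> int) \<Rightarrow> ('n \<Rightarrow> real) \<Rightarrow> real ^ 'n" where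
  "img h z r = (\<Sum>k=1..K. (t k - t (k - 1)) *\<^sub>R pt h k z r)"

lemma pt_in_unit_box:
  assumes "z \<in> cells h" "\<And>j. 0 \<le> r j \<and> r j < 1"
  shows "pt h k z r \<in> unit_box"
  using sel(1)[OF assms(1), of k] assms(2)
  unfolding cells_def pt_def mem_Collect_eq
  by (elim allE[of _ "\<lambda>j. if k \<le> w j then r j else 0"]) auto

lemma pt_cong:
  assumes "\<And>j. k \<le> w j \<Longrightarrow> z j = z' j \<and> r j = r' j"
  shows "pt h k z r = pt h k z' r'"
proof -
  have "sel h k z = sel h k z'" using assms by (intro sel_cong) auto
  moreover have "(\<lambda>j. if k \<le> w j then r j else 0) = (\<lambda>j. if k \<le> w j then r' j else 0)"
    using assms by auto
  ultimately show ?thesis unfolding pt_def by metis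
qed

text \<open>The offset \<open>r j\<close> occurs exactly in the terms with
  \<open>k \<le> w j\<close>, whose weights telescope to \<open>t (w j)\<close>.\<close>

lemma Y_img:
  "Y (img h z r) $ j
    = h * ((\<Sum>k=1..K. (t k - t (k - 1)) * of_int (sel h k z j)) + t (w j) * r j)"
proof -
  interpret Y: linear Y by (rule linear_Y)
  have "{1..K} \<inter> {k. k \<le> w j} = {1..w j}" using w_range[of j] by auto
  then have e: "(\<Sum>k=1..K. (t k - t (k - 1)) * (if k \<le> w j then r j else 0)) = t (w j) * r j"
    using telescope[of "w j"]
    by (simp add: if_distrib[of "(*) _"] sum.If_cases sum_distrib_right[symmetric])
  have "Y (img h z r) $ j = (\<Sum>k=1..K. (t k - t (k - 1))
      * (h * (of_int (sel h k z j) + (if k \<le> w j then r j else 0))))"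
    by (simp add: img_def Y.sum Y.scale pt_def P_def)
  also have "\<dots> = h * ((\<Sum>k=1..K. (t k - t (k - 1)) * of_int (sel h k z j))
      + (\<Sum>k=1..K. (t k - t (k - 1)) * (if k \<le> w j then r j else 0)))"
    unfolding sum.distrib[symmetric] sum_distrib_left by (intro sum.cong) (auto simp: algebra_simps)
  finally show ?thesis unfolding e .
qed

text \<open>The terms with k > m agree, and in the others two points of the unit box differ by less
  than 1 in each coordinate, so the weights up to m bound the difference. Increments may vanish;
  strictness comes from the first one, which is positive.\<close>

lemma img_diff_small:
  assumes z: "z \<in> cells h" "z' \<in> cells h"
    and r: "\<And>j. 0 \<le> r j \<and> r j < 1" "\<And>j. 0 \<le> r' j \<and> r' j < 1"
    and m: "m \<in> {1..K}" "\<And>j. m < w j \<Longrightarrow> z j = z' j \<and> r j = r' j"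
  shows "\<bar>(img h z r - img h z' r') $ i\<bar> < t m"
proof -
  let ?d = "\<lambda>k. (pt h k z r - pt h k z' r') $ i"
  have d: "\<bar>?d k\<bar> < 1" for k
    using pt_in_unit_box[OF z(1), of r k] pt_in_unit_box[OF z(2), of r' k] r
    unfolding unit_box_def by (auto simp: abs_less_iff) (smt (verit))+
  have "(img h z r - img h z' r') $ i = (\<Sum>k=1..K. (t k - t (k - 1)) * ?d k)"
    by (simp add: img_def sum_subtractf[symmetric] algebra_simps)
  also have "\<dots> = (\<Sum>k=1..m. (t k - t (k - 1)) * ?d k)"
  proof (rule sum.mono_neutral_right)
    show "\<forall>k\<in>{1..K} - {1..m}. (t k - t (k - 1)) * ?d k = 0"
    proof
      fix k assume "k \<in> {1..K} - {1..m}"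
      then have "pt h k z r = pt h k z' r'" using m(2) by (intro pt_cong) auto
      then show "(t k - t (k - 1)) * ?d k = 0" by simp
    qed
  qed (use m in auto)
  finally have "\<bar>(img h z r - img h z' r') $ i\<bar> \<le> (\<Sum>k=1..m. \<bar>(t k - t (k - 1)) * ?d k\<bar>)"
    by (simp only: sum_abs)
  also have "\<dots> < (\<Sum>k=1..m. t k - t (k - 1))"
  proof (rule sum_strict_mono_ex1)
    show "\<forall>k\<in>{1..m}. \<bar>(t k - t (k - 1)) * ?d k\<bar> \<le> t k - t (k - 1)"
    proof
      fix k
      have "(t k - t (k - 1)) * \<bar>?d k\<bar> \<le> (t k - t (k - 1)) * 1"
        by (intro mult_left_mono t_nonneg_diff less_imp_le d)
      then show "\<bar>(t k - t (k - 1)) * ?d k\<bar> \<le> t k - t (k - 1)"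
        using t_nonneg_diff[of k] by (simp add: abs_mult)
    qed
    have "\<bar>(t 1 - t (1 - 1)) * ?d 1\<bar> < t 1 - t (1 - 1)"
      using d[of 1] t_1 by (simp add: abs_mult t_0 del: vector_minus_component)
    then show "\<exists>k\<in>{1..m}. \<bar>(t k - t (k - 1)) * ?d k\<bar> < t k - t (k - 1)"
      using m(1) by (intro bexI[of _ 1]) auto
  qed simp
  finally show ?thesis by (simp only: telescope)
qed

text \<open>Let j be the coordinate of highest index where the two points differ. The difference of
  the images is short for index \<open>w j\<close>, so its j-th \<open>Y\<close> coordinate is 0.
  But once the higher coordinates agree, the map multiplies the j-th difference by the positive
  factor \<open>h * t (w j)\<close>.\<close>

lemma img_inj_mod_L:
  assumes z: "z \<in> cells h" "z' \<in> cells h" and h: "0 < h"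
    and r: "\<And>j. 0 \<le> r j \<and> r j < 1" "\<And>j. 0 \<le> r' j \<and> r' j < 1"
    and L: "img h z r - img h z' r' \<in> L"
  shows "z = z' \<and> r = r'"
proof (rule ccontr)
  assume ne: "\<not> (z = z' \<and> r = r')"
  define J where "J = {j. z j \<noteq> z' j \<or> r j \<noteq> r' j}"
  have "J \<noteq> {}" using ne by (auto simp: J_def fun_eq_iff)
  then obtain j where j: "j \<in> J" "\<And>i. i \<in> J \<Longrightarrow> w i \<le> w j"
    using Max_in[of "w ` J"] Max_ge[of "w ` J"] by fastforce
  have above: "z i = z' i \<and> r i = r' i" if "w j < w i" for i
    using j(2)[of i] that by (auto simp: J_def)
  let ?x = "img h z r - img h z' r'"
  interpret Y: linear Y by (rule linear_Y)
  have "?x $ j = (\<Sum>i | w i < w j. a j i * ?x $ i)"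
    using img_diff_small[OF z r w_range above] by (intro short[OF L]) auto
  then have "Y ?x $ j = 0" by (simp add: Y_def)
  moreover have "Y ?x $ j = h * (t (w j) * ((of_int (z j) + r j) - (of_int (z' j) + r' j)))"
  proof -
    define A where "A = (\<Sum>k=1..K. (t k - t (k - 1)) * of_int (sel h k z j))"
    define A' where "A' = (\<Sum>k=1..K. (t k - t (k - 1)) * of_int (sel h k z' j))"
    have "A - A' = (\<Sum>k=1..K. (t k - t (k - 1)) * (of_int (sel h k z j) - of_int (sel h k z' j) :: real))"
      by (simp add: A_def A'_def sum_subtractf[symmetric] algebra_simps)
    also have "\<dots> = (\<Sum>k=1..w j. (t k - t (k - 1)) * (of_int (sel h k z j) - of_int (sel h k z' j)))"
    proof (rule sum.mono_neutral_right)
      show "\<forall>k\<in>{1..K} - {1..w j}. (t k - t (k - 1)) * (of_int (sel h k z j) - of_int (sel h k z' j) :: real) = 0"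
      proof
        fix k assume "k \<in> {1..K} - {1..w j}"
        then have "sel h k z = sel h k z'" using above by (intro sel_cong) auto
        then show "(t k - t (k - 1)) * (of_int (sel h k z j) - of_int (sel h k z' j) :: real) = 0" by simp
      qed
    qed (use w_range[of j] in auto)
    also have "\<dots> = (\<Sum>k=1..w j. (t k - t (k - 1)) * (of_int (z j) - of_int (z' j)))"
      using sel(2)[OF z(1)] sel(2)[OF z(2)] by (intro sum.cong) auto
    also have "\<dots> = t (w j) * (of_int (z j) - of_int (z' j))"
      by (simp only: sum_distrib_right[symmetric] telescope)
    finally have A: "A = A' + t (w j) * (of_int (z j) - of_int (z' j))" by simp
    have Yx: "Y ?x $ j = h * (A + t (w j) * r j) - h * (A' + t (w j) * r' j)"
      by (simp only: Y.diff vector_minus_component Y_img A_def A'_def)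
    show ?thesis unfolding Yx A by (simp add: algebra_simps)
  qed
  ultimately have "of_int (z j) + r j = of_int (z' j) + r' j"
    using h t_pos[of "w j"] w_range[of j] by auto
  then have "z j = z' j" "r j = r' j"
    using r(1)[of j] r(2)[of j] by (smt (verit) of_int_less_iff of_int_1 of_int_add)+
  with j(1) show False by (simp add: J_def)
qed

section \<open>Volumes of the cells and of their images\<close>

definition img_box :: "real \<Rightarrow> ('n \<Rightarrow> int) \<Rightarrow> (real ^ 'n) set" where
  "img_box h z = {Y (img h z r) | r. \<forall>j. 0 \<le> r j \<and> r j < 1}"

definition cell_box :: "real \<Rightarrow> ('n \<Rightarrow> int) \<Rightarrow> (real ^ 'n) set" where
  "cell_box h z = {y. \<forall>j. h * of_int (z j) \<le> y $ j \<and> y $ j < h * of_int (z j) + h}"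

lemma img_box:
  assumes "0 < h"
  shows "bounded (img_box h z)" "img_box h z \<in> lmeasurable" "measure lebesgue (img_box h z) = (\<Prod>j\<in>UNIV. h * t (w j))"
proof -
  let ?l = "(\<chi> j. h * (\<Sum>k=1..K. (t k - t (k - 1)) * of_int (sel h k z j))) :: real ^ 'n"
  let ?s = "(\<chi> j. h * t (w j)) :: real ^ 'n"
  have pos: "0 < h * t (w j)" for j using assms t_pos[of "w j"] w_range[of j] by auto
  have "img_box h z = {y. \<forall>j. ?l $ j \<le> y $ j \<and> y $ j < ?l $ j + ?s $ j}"
  proof (intro equalityI subsetI)
    fix y assume "y \<in> img_box h z"
    then obtain r where r: "y = Y (img h z r)" "\<forall>j. 0 \<le> r j \<and> r j < 1" by (auto simp: img_box_def)
    have "y $ j = ?l $ j + h * t (w j) * r j" for j by (simp add: r(1) Y_img algebra_simps)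
    moreover have "0 \<le> h * t (w j) * r j" "h * t (w j) * r j < h * t (w j) * 1" for j
      using r(2) by (intro mult_nonneg_nonneg mult_strict_left_mono less_imp_le[OF pos] pos; simp)+
    ultimately show "y \<in> {y. \<forall>j. ?l $ j \<le> y $ j \<and> y $ j < ?l $ j + ?s $ j}" by simp
  next
    fix y assume y: "y \<in> {y. \<forall>j. ?l $ j \<le> y $ j \<and> y $ j < ?l $ j + ?s $ j}"
    define r where "r j = (y $ j - ?l $ j) / (h * t (w j))" for j
    have "0 \<le> r j \<and> r j < 1" for j
    proof -
      have "?l $ j \<le> y $ j \<and> y $ j < ?l $ j + ?s $ j" using y by blast
      then have "0 \<le> y $ j - ?l $ j" "y $ j - ?l $ j < 1 * (h * t (w j))" by auto
      with pos[of j] show ?thesis unfolding r_def by (simp only: pos_divide_less_eq divide_nonneg_pos)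
    qed
    moreover have "y = Y (img h z r)"
    proof (rule vec_eq_iff[THEN iffD2], rule allI)
      fix j
      have "c * (x / c) = x" if "0 < c" for c x :: real using that by simp
      from this[OF pos] have "h * t (w j) * r j = y $ j - ?l $ j" by (simp only: r_def)
      then show "y $ j = Y (img h z r) $ j" by (simp add: Y_img algebra_simps)
    qed
    ultimately show "y \<in> img_box h z" by (auto simp: img_box_def)
  qed
  then show "bounded (img_box h z)" "img_box h z \<in> lmeasurable" "measure lebesgue (img_box h z) = (\<Prod>j\<in>UNIV. h * t (w j))"
    using measure_half_open_box[of ?s ?l] pos by simp_all
qed

lemma cell_box:
  assumes "0 < h"
  shows "cell_box h z \<in> lmeasurable" "measure lebesgue (cell_box h z) = h ^ CARD('n)"
  using measure_half_open_box[of "\<chi> j. h" "\<chi> j. h * of_int (z j)"] assms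
  by (simp_all add: cell_box_def)

lemma finite_cells:
  assumes "0 < h"
  shows "finite (cells h)"
proof -
  have "bounded (Y ` unit_box)"
    using bounded_linear_image[OF bounded_unit_box] linear_Y by (simp add: linear_conv_bounded_linear)
  then obtain M where M: "\<And>x. x \<in> unit_box \<Longrightarrow> norm (Y x) \<le> M" by (auto simp: bounded_iff)
  define N where "N = \<lceil>M / h\<rceil>"
  have "cells h \<subseteq> PiE UNIV (\<lambda>_. {- N..N})"
  proof
    fix z assume z: "z \<in> cells h"
    have "P h (\<lambda>j. of_int (z j)) \<in> unit_box"
      using z unfolding cells_def mem_Collect_eq by (elim allE[of _ "\<lambda>_. 0"]) simp
    from M[OF this] have n: "norm ((\<chi> j. h * of_int (z j)) :: real ^ 'n) \<le> M" by (simp add: P_def)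
    have "z j \<in> {- N..N}" for j
    proof -
      have "\<bar>h * of_int (z j)\<bar> \<le> M"
        using component_le_norm_cart[of "(\<chi> j. h * of_int (z j)) :: real ^ 'n" j] n by simp
      then have "\<bar>of_int (z j) :: real\<bar> \<le> M / h"
        using assms by (simp add: abs_mult pos_le_divide_eq mult.commute)
      also have "\<dots> \<le> of_int N" by (simp add: N_def)
      finally show ?thesis by auto
    qed
    then show "z \<in> PiE UNIV (\<lambda>_. {- N..N})" by auto
  qed
  then show ?thesis by (rule finite_subset) (simp add: finite_PiE)
qed

text \<open>A copy of the unit box shrunk about its centre keeps a margin of (1 - s) / 2 on each
  side, so a cell of small diameter that meets it lies inside the unit box.\<close>

lemma shrunk_box_covered:
  assumes s: "0 < s" "s < 1"
  obtains h where "0 < h"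
    "(\<lambda>y. s *\<^sub>R y + Y (\<chi> j. (1 - s) / 2)) ` (Y ` unit_box) \<subseteq> (\<Union>z\<in>cells h. cell_box h z)"
proof -
  interpret Y: linear Y by (rule linear_Y)
  interpret T: linear T by (rule linear_T)
  obtain B where B: "0 < B" "\<And>x. norm (T x) \<le> B * norm x"
    using linear_bounded_pos[OF linear_T] by blast
  \<comment> \<open>Points of one cell are at distance at most n h in the \<open>Y\<close>
    coordinates, hence at most B n h = (1 - s) / 4 after \<open>T\<close>, which is below the
    margin.\<close>
  define h where "h = (1 - s) / (4 * B * CARD('n))"
  have n: "0 < real CARD('n)" by simp
  have h: "0 < h" using s B n by (simp add: h_def)
  have "B * (CARD('n) * h) = (1 - s) / 4" using B(1) n by (simp add: h_def field_simps)
  then have Bh: "B * (CARD('n) * h) < (1 - s) / 2" using s by simp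
  have "(\<lambda>y. s *\<^sub>R y + Y (\<chi> j. (1 - s) / 2)) ` (Y ` unit_box) \<subseteq> (\<Union>z\<in>cells h. cell_box h z)"
  proof clarify
    fix u :: "real ^ 'n" assume u: "u \<in> unit_box"
    define x where "x = s *\<^sub>R u + (\<chi> j. (1 - s) / 2)"
    have Yx: "s *\<^sub>R Y u + Y (\<chi> j. (1 - s) / 2) = Y x" by (simp add: x_def Y.add Y.scale)
    define z where "z j = \<lfloor>Y x $ j / h\<rfloor>" for j
    have z: "h * of_int (z j) \<le> Y x $ j \<and> Y x $ j < h * of_int (z j) + h" for j
    proof -
      have "of_int (z j) \<le> Y x $ j / h" "Y x $ j / h < of_int (z j) + 1"
        unfolding z_def by (rule of_int_floor_le) linarith
      then show ?thesis using h by (simp add: pos_le_divide_eq pos_divide_less_eq algebra_simps)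
    qed
    have "z \<in> cells h"
      unfolding cells_def
    proof (intro CollectI allI impI)
      fix r :: "'n \<Rightarrow> real" assume r: "\<forall>j. 0 \<le> r j \<and> r j < 1"
      let ?y = "(\<chi> j. h * (of_int (z j) + r j)) :: real ^ 'n"
      have "\<bar>(?y - Y x) $ j\<bar> \<le> h" for j
      proof -
        have "0 \<le> h * r j" "h * r j \<le> h"
          using r h by (auto intro!: mult_left_le simp: less_imp_le)
        then show ?thesis using z[of j]
          by (simp only: abs_le_iff vector_minus_component vec_lambda_beta distrib_left) linarith
      qed
      then have "norm (?y - Y x) \<le> (\<Sum>j\<in>(UNIV::'n set). h)"
        by (intro order_trans[OF norm_le_l1_cart] sum_mono)
      then have ny: "norm (?y - Y x) \<le> CARD('n) * h" by simp
      have "norm (P h (\<lambda>j. of_int (z j) + r j) - x) = norm (T (?y - Y x))"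
        by (simp add: P_def T.diff)
      also have "\<dots> \<le> B * (CARD('n) * h)"
        using B(2)[of "?y - Y x"] mult_left_mono[OF ny less_imp_le[OF B(1)]] by linarith
      finally have close: "norm (P h (\<lambda>j. of_int (z j) + r j) - x) < (1 - s) / 2" using Bh by linarith
      show "P h (\<lambda>j. of_int (z j) + r j) \<in> unit_box"
        unfolding unit_box_def
      proof (intro CollectI allI)
        fix i
        have "\<bar>P h (\<lambda>j. of_int (z j) + r j) $ i - x $ i\<bar> < (1 - s) / 2"
          using component_le_norm_cart[of "P h (\<lambda>j. of_int (z j) + r j) - x" i] close by simp
        moreover have "0 \<le> u $ i" "u $ i < 1" using u by (auto simp: unit_box_def)
        then have "0 \<le> s * u $ i" "s * u $ i \<le> s * 1"
          using s by (auto intro!: mult_left_mono simp del: mult_1_right)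
        then have "(1 - s) / 2 \<le> x $ i" "x $ i \<le> s + (1 - s) / 2"
          by (simp_all add: x_def)
        moreover have "s + (1 - s) / 2 = 1 - (1 - s) / 2" by (simp add: field_simps)
        ultimately show "0 \<le> P h (\<lambda>j. of_int (z j) + r j) $ i \<and> P h (\<lambda>j. of_int (z j) + r j) $ i < 1"
          by (intro conjI) linarith+
      qed
    qed
    moreover have "Y x \<in> cell_box h z" using z by (simp add: cell_box_def)
    ultimately show "s *\<^sub>R Y u + Y (\<chi> j. (1 - s) / 2) \<in> (\<Union>z\<in>cells h. cell_box h z)"
      unfolding Yx by blast
  qed
  with h that show thesis by blast
qed

text \<open>Let N be the total volume of the cells and C the image of the unit box under
  \<open>Y\<close>. Covering gives s^n vol(C) \<le> N. The images of the cells are disjoint and have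
  volume N times the product of the radii, and packing bounds \<open>card X\<close> times this by
  vol(C). Chaining the two eliminates vol(C), and N cancels.\<close>

lemma card_mult_prod_scaled_le_1:
  assumes X: "finite X" "X \<subseteq> L \<inter> unit_box" and s: "0 < s" "s < 1"
  shows "s ^ CARD('n) * (card X * (\<Prod>j\<in>UNIV. t (w j))) \<le> 1"
proof -
  let ?C = "Y ` unit_box" and ?t = "\<Prod>j\<in>UNIV. t (w j)"
  have Cm: "?C \<in> lmeasurable"
    using bounded_linear_image[OF bounded_unit_box] linear_Y
    by (intro measurable_convex convex_linear_image convex_unit_box) (auto simp: linear_conv_bounded_linear)
  obtain h where h: "0 < h" and cover:
    "(\<lambda>y. s *\<^sub>R y + Y (\<chi> j. (1 - s) / 2)) ` ?C \<subseteq> (\<Union>z\<in>cells h. cell_box h z)" (is "?Q \<subseteq> _")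
    using shrunk_box_covered[OF s] .
  note fin = finite_cells[OF h]
  let ?N = "card (cells h) * h ^ CARD('n)"
  have "0 \<in> (unit_box :: (real ^ 'n) set)" by (simp add: unit_box_def)
  then have "cells h \<noteq> {}" using cover by fastforce
  then have N: "0 < ?N" using fin h by (simp add: card_gt_0_iff)
  have t: "0 < ?t" using t_pos w_range by (intro prod_pos) auto
  have "s ^ CARD('n) * measure lebesgue ?C = measure lebesgue ?Q"
    using measure_lebesgue_affine[of s "Y (\<chi> j. (1 - s) / 2)" ?C] s by (simp add: ac_simps)
  also have "\<dots> \<le> measure lebesgue (\<Union>z\<in>cells h. cell_box h z)"
  proof (rule measure_mono_fmeasurable[OF cover])
    have "?Q = (+) (Y (\<chi> j. (1 - s) / 2)) ` (*\<^sub>R) s ` ?C" by (auto simp: image_image add.commute)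
    moreover have "(*\<^sub>R) s ` ?C \<in> lmeasurable"
      using Cm bounded_linear_image[OF bounded_unit_box] linear_Y
      by (intro measurable_convex convex_scaling convex_linear_image convex_unit_box bounded_scaling)
        (auto simp: linear_conv_bounded_linear)
    ultimately show "?Q \<in> sets lebesgue" using measurable_translation by (metis fmeasurableD)
    show "(\<Union>z\<in>cells h. cell_box h z) \<in> lmeasurable"
      by (rule fmeasurable.finite_UN[OF fin]) (rule cell_box(1)[OF h])
  qed
  also have "\<dots> \<le> (\<Sum>z\<in>cells h. measure lebesgue (cell_box h z))"
    by (intro measure_UNION_le fin fmeasurableD cell_box h)
  also have "\<dots> = ?N" by (simp add: cell_box(2)[OF h])
  finally have upper: "s ^ CARD('n) * measure lebesgue ?C \<le> ?N" .
  let ?E = "\<Union>z\<in>cells h. img_box h z"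
  interpret Y: linear Y by (rule linear_Y)
  have disj: "z = z' \<and> r = r'"
    if "z \<in> cells h" "z' \<in> cells h" "\<forall>j. 0 \<le> r j \<and> r j < 1" "\<forall>j. 0 \<le> r' j \<and> r' j < 1"
      "img h z r - img h z' r' \<in> L" for z z' r r'
    using img_inj_mod_L[OF that(1,2) h _ _ that(5)] that(3,4) by blast
  have "measure lebesgue ?E = (\<Sum>z\<in>cells h. measure lebesgue (img_box h z))"
  proof (rule measure_UNION'[OF fin])
    show "img_box h z \<in> lmeasurable" for z by (rule img_box(2)[OF h])
    show "pairwise (\<lambda>z z'. disjnt (img_box h z) (img_box h z')) (cells h)"
    proof (rule pairwiseI)
      fix z z' assume z: "z \<in> cells h" "z' \<in> cells h" "z \<noteq> z'"
      show "disjnt (img_box h z) (img_box h z')"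
        unfolding disjnt_iff
      proof (intro allI notI)
        fix y assume "y \<in> img_box h z \<and> y \<in> img_box h z'"
        then obtain r r' where r: "Y (img h z r) = Y (img h z' r')"
          "\<forall>j. 0 \<le> r j \<and> r j < 1" "\<forall>j. 0 \<le> r' j \<and> r' j < 1" by (auto simp: img_box_def)
        have "img h z r = img h z' r'" using injD[OF inj_Y r(1)] .
        moreover have "0 \<in> L" using L_lattice zero_in_lattice by auto
        ultimately show False using disj[OF z(1,2) r(2,3)] z(3) by simp
      qed
    qed
  qed
  also have "\<dots> = ?N * ?t" by (simp add: img_box(3)[OF h] prod.distrib)
  finally have E: "measure lebesgue ?E = ?N * ?t" .
  have pack: "card X' * (?N * ?t) \<le> measure lebesgue ?C" if "finite X'" "X' \<subseteq> L \<inter> unit_box" for X'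
    unfolding E[symmetric]
  proof (rule packing_bound[where T = T and L = L])
    show "bounded ?E" by (intro bounded_UN fin ballI img_box(1)[OF h])
    show "?E \<in> lmeasurable" by (rule fmeasurable.finite_UN[OF fin]) (rule img_box(2)[OF h])
    show "x = y" if "x \<in> ?E" "y \<in> ?E" "T (x - y) \<in> L" for x y
    proof -
      obtain z r where x: "z \<in> cells h" "x = Y (img h z r)" "\<forall>j. 0 \<le> r j \<and> r j < 1"
        using \<open>x \<in> ?E\<close> by (auto simp: img_box_def)
      obtain z' r' where y: "z' \<in> cells h" "y = Y (img h z' r')" "\<forall>j. 0 \<le> r' j \<and> r' j < 1"
        using \<open>y \<in> ?E\<close> by (auto simp: img_box_def)
      have "T (x - y) = img h z r - img h z' r'"
        unfolding x(2) y(2) Y.diff[symmetric] by (rule T_Y)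
      then show ?thesis using disj[OF x(1) y(1) x(3) y(3)] that(3) x(2) y(2) by simp
    qed
  qed (use that L_lattice L_diff linear_Y in auto)
  have "?N * (s ^ CARD('n) * (card X * ?t)) = s ^ CARD('n) * (card X * (?N * ?t))"
    by (simp add: ac_simps)
  also have "\<dots> \<le> s ^ CARD('n) * measure lebesgue ?C"
    using pack[OF X] s by (intro mult_left_mono) auto
  also have "\<dots> \<le> ?N * 1" using upper by simp
  finally show ?thesis using N by (simp only: mult_le_cancel_left_pos)
qed

theorem card_mult_prod_le_1:
  assumes X: "finite X" "X \<subseteq> L \<inter> unit_box"
  shows "card X * (\<Prod>j\<in>UNIV. t (w j)) \<le> 1"
proof (rule field_le_mult_one_interval)
  fix z :: real assume z: "0 < z" "z < 1"
  \<comment> \<open>The shrinking factor enters as s^n, so s is the n-th root of an arbitrary number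
    below 1.\<close>
  let ?s = "root CARD('n) z"
  have "?s ^ CARD('n) = z" using z by (intro real_root_pow_pos) auto
  moreover have "0 < ?s" "?s < 1" using z by auto
  ultimately show "z * (card X * (\<Prod>j\<in>UNIV. t (w j))) \<le> 1"
    using card_mult_prod_scaled_le_1[OF X, of ?s] by simp
qed

end

section \<open>Triangular elimination of coordinates\<close>

text \<open>The projection of \<open>V\<close> to the coordinates in \<open>I\<close> spans a proper
  subspace of the coordinate space. A nonzero vector orthogonal to it there is a linear relation,
  solvable for any coordinate with nonzero coefficient.\<close>

lemma coordinate_dependence:
  fixes V :: "(real ^ 'n) set"
  assumes "dim V < card I"
  obtains i c where "i \<in> I" "\<And>x. x \<in> V \<Longrightarrow> x $ i = (\<Sum>j\<in>I - {i}. c j * x $ j)"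
proof -
  define pr :: "real ^ 'n \<Rightarrow> real ^ 'n" where "pr x = (\<chi> j. if j \<in> I then x $ j else 0)" for x
  have lin: "linear pr" by (rule linearI) (auto simp: pr_def vec_eq_iff)
  define A :: "(real ^ 'n) set" where "A = (\<lambda>i. axis i 1) ` I"
  have "independent A"
    by (rule independent_mono[OF independent_Basis]) (auto simp: A_def Basis_vec_def)
  moreover have "card A = card I"
    unfolding A_def by (rule card_image) (auto simp: inj_on_def axis_eq_axis)
  ultimately have dA: "dim (span A) = card I" by (simp add: dim_eq_card_independent)
  have "pr x \<in> span A" for x
  proof -
    have "pr x = (\<Sum>i\<in>I. x $ i *\<^sub>R axis i 1)"
      by (auto simp: vec_eq_iff pr_def axis_def if_distrib[of "(*) _"] sum.delta cong: if_cong)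
    also have "\<dots> \<in> span A" by (intro span_sum span_scale span_base) (auto simp: A_def)
    finally show ?thesis .
  qed
  then have "span (pr ` V) \<subseteq> span A" by (intro span_minimal) auto
  moreover have "dim (span (pr ` V)) < dim (span A)"
    using dim_image_le[OF lin, of V] assms dA by simp
  ultimately have "span (pr ` V) \<subset> span A" by (metis less_irrefl psubsetI)
  then obtain c where c: "c \<noteq> 0" "c \<in> span A" "\<And>y. y \<in> span (pr ` V) \<Longrightarrow> orthogonal c y"
    using orthogonal_to_subspace_exists_gen[of "pr ` V" A] by metis
  have "span A \<subseteq> {c. \<forall>j. j \<notin> I \<longrightarrow> c $ j = 0}"
    by (rule span_minimal) (auto simp: A_def axis_def subspace_def)
  with c(2) have supp: "c $ j = 0" if "j \<notin> I" for j using that by auto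
  obtain i where i: "c $ i \<noteq> 0" using c(1) by (auto simp: vec_eq_iff)
  with supp have "i \<in> I" by auto
  show thesis
  proof
    show "i \<in> I" by fact
    fix x assume "x \<in> V"
    then have "c \<bullet> pr x = 0" using c(3)[of "pr x"] by (auto simp: orthogonal_def intro: span_base)
    also have "c \<bullet> pr x = (\<Sum>j\<in>I. c $ j * x $ j)"
      by (simp add: inner_vec_def pr_def if_distrib[of "(*) _"] sum.If_cases)
    also have "\<dots> = c $ i * x $ i + (\<Sum>j\<in>I - {i}. c $ j * x $ j)"
      using \<open>i \<in> I\<close> by (intro sum.remove) auto
    finally have "x $ i = - (\<Sum>j\<in>I - {i}. c $ j * x $ j) / c $ i"
      using i by (simp add: field_simps add_eq_0_iff)
    also have "\<dots> = (\<Sum>j\<in>I - {i}. (- c $ j / c $ i) * x $ j)"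
      by (simp add: sum_divide_distrib sum_negf[symmetric])
    finally show "x $ i = (\<Sum>j\<in>I - {i}. (- c $ j / c $ i) * x $ j)" .
  qed
qed

text \<open>At stage k exactly k coordinates are left while \<open>dim (V k) < k\<close>, so one of
  them depends on the others over \<open>V k\<close>; it receives the index k.\<close>

lemma triangular_elimination:
  fixes V :: "nat \<Rightarrow> (real ^ 'n) set"
  assumes "card I = n" "\<And>k. k \<in> {1..n} \<Longrightarrow> dim (V k) < k"
  shows "\<exists>w a. bij_betw w I {1..n} \<and>
    (\<forall>j\<in>I. \<forall>x\<in>V (w j). x $ j = (\<Sum>i | i \<in> I \<and> w i < w j. a j i * x $ i))"
  using assms
proof (induction n arbitrary: I)
  case 0
  then have "I = {}" by simp
  then show ?case by (auto simp: bij_betw_def)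
next
  case (Suc n)
  have "dim (V (Suc n)) < card I" using Suc.prems by auto
  then obtain i c where i: "i \<in> I" "\<And>x. x \<in> V (Suc n) \<Longrightarrow> x $ i = (\<Sum>j\<in>I - {i}. c j * x $ j)"
    by (rule coordinate_dependence) blast
  have "card (I - {i}) = n" using Suc.prems(1) i(1) by simp
  then have "\<exists>w a. bij_betw w (I - {i}) {1..n} \<and> (\<forall>j\<in>I - {i}. \<forall>x\<in>V (w j).
      x $ j = (\<Sum>k | k \<in> I - {i} \<and> w k < w j. a j k * x $ k))"
    by (rule Suc.IH) (use Suc.prems(2) in auto)
  then obtain w a where wa: "bij_betw w (I - {i}) {1..n}"
    "\<forall>j\<in>I - {i}. \<forall>x\<in>V (w j). x $ j = (\<Sum>k | k \<in> I - {i} \<and> w k < w j. a j k * x $ k)"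
    by (elim exE conjE)
  have wle: "w j \<le> n" if "j \<in> I - {i}" for j using bij_betwE[OF wa(1)] that by auto
  let ?w = "w(i := Suc n)" and ?a = "a(i := c)"
  have "bij_betw ?w (I - {i}) {1..n}"
    using wa(1) by (subst bij_betw_cong[where g = w]) auto
  moreover have "bij_betw ?w {i} {Suc n}" by (simp add: bij_betw_def)
  ultimately have "bij_betw ?w ((I - {i}) \<union> {i}) ({1..n} \<union> {Suc n})"
    by (rule bij_betw_combine) auto
  moreover have "(I - {i}) \<union> {i} = I" "{1..n} \<union> {Suc n} = {1..Suc n}" using i(1) by auto
  ultimately have bij: "bij_betw ?w I {1..Suc n}" by simp
  show ?case
  proof (intro exI[of _ ?w] exI[of _ ?a] conjI ballI)
    show "bij_betw ?w I {1..Suc n}" by (rule bij)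
    fix j x assume j: "j \<in> I" and x: "x \<in> V (?w j)"
    show "x $ j = (\<Sum>k | k \<in> I \<and> ?w k < ?w j. ?a j k * x $ k)"
    proof (cases "j = i")
      case True
      have "{k. k \<in> I \<and> ?w k < Suc n} = I - {i}" using wle by (auto simp: less_Suc_eq_le)
      with True x i(2) show ?thesis by simp
    next
      case False
      then have j': "j \<in> I - {i}" using j by simp
      have "{k. k \<in> I \<and> ?w k < ?w j} = {k. k \<in> I - {i} \<and> w k < w j}"
        using wle[OF j'] False by auto
      with False x wa(2)[rule_format, OF j'] show ?thesis by simp
    qed
  qed
qed

text \<open>To stay in dimension n, points over S are padded by integer coordinates outside S. A
  padded coordinate gets radius 1, below which an integer vanishes: it contributes a factor 1 to the
  product and drops out of the relations within S.\<close>

lemma card_frac_pts_bound: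
  fixes v :: "nat \<Rightarrow> real ^ 'n" and e :: "'n \<Rightarrow> nat" and w :: "'n \<Rightarrow> nat"
  assumes e: "inj e" "\<And>j. v (e j) \<in> lattice"
    and w: "inj w" "\<And>j. w j \<in> {1..CARD('n)}"
    and lam: "\<And>k. k \<in> {1..CARD('n)} \<Longrightarrow> 0 < lam k \<and> lam k \<le> 1"
      "\<And>k l. 1 \<le> k \<Longrightarrow> k \<le> l \<Longrightarrow> l \<le> CARD('n) \<Longrightarrow> lam k \<le> lam l"
    and short: "\<And>x j. (\<Sum>i\<in>UNIV. x $ i *\<^sub>R v (e i)) \<in> lattice \<Longrightarrow> \<forall>i. \<bar>x $ i\<bar> < lam (w j)
      \<Longrightarrow> x $ j = (\<Sum>i | w i < w j. a j i * x $ i)"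
  shows "card (frac_pts v {} (e ` S)) \<le> (\<Prod>j\<in>S. 1 / lam (w j))"
proof (cases "finite (frac_pts v {} (e ` S))")
  case False
  then show ?thesis using lam w by (simp add: prod_nonneg less_imp_le)
next
  case True
  let ?n = "CARD('n)"
  define L :: "(real ^ 'n) set" where
    "L = {x. (\<forall>j. j \<notin> S \<longrightarrow> x $ j \<in> \<int>) \<and> (\<Sum>j\<in>S. x $ j *\<^sub>R v (e j)) \<in> lattice}"
  \<comment> \<open>Coordinates outside S go behind those of S, because their radius 1 is at least
    every \<open>lam k\<close>.\<close>
  define w' where "w' j = (if j \<in> S then w j else ?n + w j)" for j
  define t where "t k = (if k = 0 then 0 else if k \<le> ?n then lam k else 1)" for k
  define a' where "a' j i = (if j \<in> S \<and> i \<in> S then a j i else 0)" for j i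
  have lat_sum: "(\<Sum>j\<in>A. f j) \<in> lattice" if "\<And>j. j \<in> A \<Longrightarrow> f j \<in> lattice"
    for f :: "'n \<Rightarrow> real ^ 'n" and A
    using that by (induction A rule: infinite_finite_induct) (auto simp: zero_in_lattice lattice_add)
  interpret triangular_minima L w' "2 * ?n" t a'
  proof
    show "x - y \<in> L" if "x \<in> L" "y \<in> L" for x y
    proof -
      have "(\<Sum>j\<in>S. (x - y) $ j *\<^sub>R v (e j)) = (\<Sum>j\<in>S. x $ j *\<^sub>R v (e j)) - (\<Sum>j\<in>S. y $ j *\<^sub>R v (e j))"
        by (simp add: sum_subtractf scaleR_diff_left)
      then show ?thesis using that by (auto simp: L_def intro: lattice_diff)
    qed
    show "lattice \<subseteq> L"
    proof
      fix x :: "real ^ 'n" assume x: "x \<in> lattice"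
      have "x $ j *\<^sub>R v (e j) \<in> lattice" for j
      proof -
        have "x $ j \<in> \<int>" using x by (simp add: lattice_def)
        then show ?thesis by (rule Ints_cases) (use lattice_scale_int[OF e(2)] in simp)
      qed
      then have "(\<Sum>j\<in>S. x $ j *\<^sub>R v (e j)) \<in> lattice" by (rule lat_sum)
      moreover have "x $ j \<in> \<int>" for j using x by (simp add: lattice_def)
      ultimately show "x \<in> L" by (simp add: L_def)
    qed
    show "inj w'"
    proof (rule injI)
      fix i j assume "w' i = w' j"
      then have "w i = w j" using w(2)[of i] w(2)[of j] by (auto simp: w'_def split: if_splits)
      then show "i = j" using w(1) by (simp add: inj_eq)
    qed
    show "w' j \<in> {1..2 * ?n}" for j using w(2)[of j] by (auto simp: w'_def)
    show "t 0 = 0" by (simp add: t_def)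
    have "1 \<le> ?n" by (simp add: Suc_leI)
    then show "0 < t 1" using lam(1)[of 1] by (simp add: t_def)
    show "t k \<le> t (Suc k)" for k
    proof (cases "k = 0 \<or> Suc k > ?n")
      case True
      then show ?thesis using lam(1)[of k] lam(1)[of 1] by (auto simp: t_def less_imp_le)
    next
      case False
      then show ?thesis using lam(2)[of k "Suc k"] by (auto simp: t_def)
    qed
    show "x $ j = (\<Sum>i | w' i < w' j. a' j i * x $ i)"
      if x: "x \<in> L" and small: "\<forall>i. \<bar>x $ i\<bar> < t (w' j)" for x j
    proof -
      have "t (w' j) \<le> 1" using lam(1)[of "w' j"] by (auto simp: t_def)
      then have lt1: "\<bar>x $ i\<bar> < 1" for i using small by (meson less_le_trans)
      have zero: "x $ i = 0" if "i \<notin> S" for i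
      proof -
        have "x $ i \<in> \<int>" using x that by (simp add: L_def)
        then show ?thesis using lt1[of i] by (rule_tac Ints_cases) auto
      qed
      show ?thesis
      proof (cases "j \<in> S")
        case False
        then show ?thesis using zero[OF False] by (simp add: a'_def)
      next
        case True
        have "(\<Sum>i\<in>UNIV. x $ i *\<^sub>R v (e i)) = (\<Sum>i\<in>S. x $ i *\<^sub>R v (e i))"
          using zero by (intro sum.mono_neutral_right) auto
        then have mem: "(\<Sum>i\<in>UNIV. x $ i *\<^sub>R v (e i)) \<in> lattice" using x by (simp add: L_def)
        have "t (w' j) = lam (w j)" using w(2)[of j] True by (auto simp: t_def w'_def)
        with small have "x $ j = (\<Sum>i | w i < w j. a j i * x $ i)"
          by (intro short[OF mem]) simp
        also have "\<dots> = (\<Sum>i | i \<in> S \<and> w i < w j. a j i * x $ i)"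
          using zero by (intro sum.mono_neutral_right) auto
        also have "\<dots> = (\<Sum>i | i \<in> S \<and> w i < w j. a' j i * x $ i)"
          using True by (intro sum.cong) (auto simp: a'_def)
        also have "\<dots> = (\<Sum>i | w' i < w' j. a' j i * x $ i)"
          using True zero by (intro sum.mono_neutral_left) (auto simp: w'_def split: if_splits)
        finally show ?thesis .
      qed
    qed
  qed
  define \<phi> :: "(nat \<Rightarrow> real) \<Rightarrow> real ^ 'n" where "\<phi> f = (\<chi> j. if j \<in> S then f (e j) else 0)" for f
  have "inj_on \<phi> (frac_pts v {} (e ` S))"
  proof (rule inj_onI)
    fix f g assume f: "f \<in> frac_pts v {} (e ` S)" and g: "g \<in> frac_pts v {} (e ` S)" and eq: "\<phi> f = \<phi> g"
    have "f (e j) = g (e j)" if "j \<in> S" for j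
      using eq that by (auto simp: \<phi>_def vec_eq_iff split: if_splits)
    then show "f = g"
      using f g unfolding frac_pts_def by (blast intro: PiE_ext)
  qed
  moreover have "\<phi> ` frac_pts v {} (e ` S) \<subseteq> L \<inter> unit_box"
  proof (rule image_subsetI)
    fix f assume f: "f \<in> frac_pts v {} (e ` S)"
    have "(\<Sum>s\<in>e ` S. f s *\<^sub>R v s) = (\<Sum>j\<in>S. f (e j) *\<^sub>R v (e j))"
      using e(1) by (subst sum.reindex) (auto simp: inj_on_def)
    also have "\<dots> = (\<Sum>j\<in>S. \<phi> f $ j *\<^sub>R v (e j))" by (intro sum.cong) (auto simp: \<phi>_def)
    finally have "(\<Sum>j\<in>S. \<phi> f $ j *\<^sub>R v (e j)) \<in> lattice"
      using f by (auto simp: frac_pts_def mod_span_def)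
    then have "\<phi> f \<in> L" by (simp add: L_def \<phi>_def)
    moreover have "\<phi> f \<in> unit_box" using f by (auto simp: unit_box_def \<phi>_def frac_pts_def PiE_def Pi_def)
    ultimately show "\<phi> f \<in> L \<inter> unit_box" by simp
  qed
  ultimately have "card (frac_pts v {} (e ` S)) * (\<Prod>j\<in>UNIV. t (w' j)) \<le> 1"
    using card_mult_prod_le_1[of "\<phi> ` frac_pts v {} (e ` S)"] True by (simp add: card_image)
  moreover have "(\<Prod>j\<in>UNIV. t (w' j)) = (\<Prod>j\<in>S. t (w' j))"
  proof (rule prod.mono_neutral_right)
    show "\<forall>j\<in>UNIV - S. t (w' j) = 1"
    proof
      fix j assume "j \<in> UNIV - S"
      then have "?n < w' j" using w(2)[of j] by (simp add: w'_def)
      then show "t (w' j) = 1" by (simp add: t_def)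
    qed
  qed auto
  moreover have "(\<Prod>j\<in>S. t (w' j)) = (\<Prod>j\<in>S. lam (w j))"
  proof (rule prod.cong[OF refl])
    fix j assume "j \<in> S"
    then show "t (w' j) = lam (w j)" using w(2)[of j] by (simp add: t_def w'_def)
  qed
  moreover have "0 < (\<Prod>j\<in>S. lam (w j))" using lam(1) w(2) by (intro prod_pos) auto
  ultimately show ?thesis by (simp add: prod_dividef pos_le_divide_eq)
qed

section \<open>Successive minima of zonotopes\<close>

lemma zonotope_eq_zon: "zonotope v m = zon v 1 {..<m}"
  by (auto simp: zonotope_def zon_def)

lemma diff_body_zonotope:
  assumes "\<forall>i<m. \<bar>s i\<bar> \<le> 1"
  shows "(\<Sum>i<m. s i *\<^sub>R v i) \<in> diff_body (zonotope v m)"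
proof -
  have "(\<Sum>i<m. s i *\<^sub>R v i) = (\<Sum>i<m. max 0 (s i) *\<^sub>R v i) - (\<Sum>i<m. max 0 (- s i) *\<^sub>R v i)"
    unfolding sum_subtractf[symmetric] scaleR_diff_left[symmetric] by (intro sum.cong) auto
  moreover have "(\<Sum>i<m. max 0 (s i) *\<^sub>R v i) \<in> zonotope v m"
    unfolding zonotope_def by (intro CollectI exI[of _ "\<lambda>i. max 0 (s i)"]) (use assms in auto)
  moreover have "(\<Sum>i<m. max 0 (- s i) *\<^sub>R v i) \<in> zonotope v m"
    unfolding zonotope_def by (intro CollectI exI[of _ "\<lambda>i. max 0 (- s i)"]) (use assms in auto)
  ultimately show ?thesis unfolding diff_body_def by blast
qed

text \<open>The other generators get coefficient 0. This inclusion of a cube is the only link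
  between DZ and the coordinates of the chosen generators.\<close>

lemma scaled_diff_body_zonotope:
  fixes v :: "nat \<Rightarrow> real ^ 'n" and e :: "'n \<Rightarrow> nat"
  assumes e: "inj e" "\<And>j. e j < m" and l: "0 < l" "\<And>j. \<bar>x $ j\<bar> \<le> l"
  shows "(\<Sum>j\<in>UNIV. x $ j *\<^sub>R v (e j)) \<in> (*\<^sub>R) l ` diff_body (zonotope v m)"
proof -
  define s where "s i = (if i \<in> range e then x $ (inv e i) / l else 0)" for i
  have se: "s (e j) = x $ j / l" for j by (simp add: s_def e(1))
  have "\<forall>i<m. \<bar>s i\<bar> \<le> 1" using l by (auto simp: s_def)
  then have mem: "(\<Sum>i<m. s i *\<^sub>R v i) \<in> diff_body (zonotope v m)" by (rule diff_body_zonotope)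
  have "(\<Sum>i<m. s i *\<^sub>R v i) = (\<Sum>i\<in>range e. s i *\<^sub>R v i)"
    using e(2) by (intro sum.mono_neutral_right) (auto simp: s_def)
  also have "\<dots> = (\<Sum>j\<in>UNIV. (x $ j / l) *\<^sub>R v (e j))"
    using e(1) by (simp add: sum.reindex se)
  finally have "(\<Sum>j\<in>UNIV. x $ j *\<^sub>R v (e j)) = l *\<^sub>R (\<Sum>i<m. s i *\<^sub>R v i)"
    using l(1) by (simp add: scaleR_sum_right)
  with mem show ?thesis by blast
qed

definition dilates :: "nat \<Rightarrow> (real ^ 'n) set \<Rightarrow> real set" where
  "dilates i K = {l. l > 0 \<and> aff_dim (((*\<^sub>R) l ` K) \<inter> lattice) \<ge> int i}"

lemma succ_min_alt: "succ_min i K = Inf (dilates i K)"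
  by (simp add: succ_min_def dilates_def)

lemma bdd_below_dilates: "bdd_below (dilates i K)"
  by (rule bdd_belowI[of _ 0]) (auto simp: dilates_def)

lemma succ_min_le: "l \<in> dilates i K \<Longrightarrow> succ_min i K \<le> l"
  unfolding succ_min_alt by (rule cInf_lower[OF _ bdd_below_dilates])

text \<open>For smaller i more dilates are admissible. Nonemptiness at j rules out the arbitrary
  value of the infimum of the empty set.\<close>

lemma succ_min_mono:
  assumes "i \<le> j" "dilates j K \<noteq> {}"
  shows "succ_min i K \<le> succ_min j K"
  unfolding succ_min_alt using assms
  by (intro cInf_superset_mono bdd_below_dilates) (auto simp: dilates_def)

text \<open>A nonzero lattice vector has norm at least 1. If K lies in the ball of radius R about 0,
  its dilate by l contains such a vector only for l at least 1 / R.\<close>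

lemma succ_min_pos:
  fixes K :: "(real ^ 'n) set"
  assumes "bounded K" "1 \<le> i" "dilates i K \<noteq> {}"
  shows "0 < succ_min i K"
proof -
  obtain R where R: "0 < R" "\<And>x. x \<in> K \<Longrightarrow> norm x \<le> R"
    using assms(1) by (auto simp: bounded_pos)
  have "1 / R \<le> l" if "l \<in> dilates i K" for l
  proof -
    have l: "0 < l" "aff_dim (((*\<^sub>R) l ` K) \<inter> lattice) \<ge> 1" using that assms(2) by (auto simp: dilates_def)
    have "\<not> ((*\<^sub>R) l ` K) \<inter> lattice \<subseteq> {0}"
      using l(2) aff_dim_subset[of "((*\<^sub>R) l ` K) \<inter> lattice" "{0}"] by auto
    then obtain y where "y \<in> ((*\<^sub>R) l ` K) \<inter> lattice" "y \<noteq> 0" by blast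
    then obtain x where x: "x \<in> K" "l *\<^sub>R x \<in> lattice" "l *\<^sub>R x \<noteq> 0" by blast
    then obtain j where j: "(l *\<^sub>R x) $ j \<noteq> 0" by (metis vec_eq_iff zero_index)
    have "(l *\<^sub>R x) $ j \<in> \<int>" using x(2) by (simp add: lattice_def)
    then have "1 \<le> \<bar>(l *\<^sub>R x) $ j\<bar>" using j Ints_nonzero_abs_ge1 by blast
    also have "\<dots> \<le> norm (l *\<^sub>R x)" by (rule component_le_norm_cart)
    also have "\<dots> \<le> l * R" using R(2)[OF x(1)] l(1) by simp
    finally show ?thesis using R(1) by (simp add: pos_divide_le_eq mult.commute)
  qed
  then have "1 / R \<le> succ_min i K"
    unfolding succ_min_alt using assms(3) by (intro cInf_greatest)
  then show ?thesis using R(1) by (meson divide_pos_pos less_le_trans zero_less_one)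
qed

lemma bounded_diff_body_zonotope: "bounded (diff_body (zonotope v m))"
proof -
  have "bounded (zonotope v m)"
    unfolding zonotope_eq_zon by (intro compact_imp_bounded compact_zon) simp
  then have "bounded ((\<lambda>(x, y). x - y) ` (zonotope v m \<times> zonotope v m))"
    by (intro bounded_minus)
  moreover have "diff_body (zonotope v m) = (\<lambda>(x, y). x - y) ` (zonotope v m \<times> zonotope v m)"
    by (auto simp: diff_body_def)
  ultimately show ?thesis by simp
qed

lemma independent_coordinates:
  fixes u :: "'n::finite \<Rightarrow> real ^ 'n"
  assumes "inj u" "independent (range u)"
  shows "linear (\<lambda>x :: real ^ 'n. \<Sum>j\<in>UNIV. x $ j *\<^sub>R u j)" "inj (\<lambda>x :: real ^ 'n. \<Sum>j\<in>UNIV. x $ j *\<^sub>R u j)"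
proof -
  show lin: "linear (\<lambda>x :: real ^ 'n. \<Sum>j\<in>UNIV. x $ j *\<^sub>R u j)"
    by (rule linearI) (auto simp: sum.distrib scaleR_add_left scaleR_sum_right)
  show "inj (\<lambda>x :: real ^ 'n. \<Sum>j\<in>UNIV. x $ j *\<^sub>R u j)"
    unfolding linear_injective_0[OF lin]
  proof (intro allI impI)
    fix x :: "real ^ 'n" assume "(\<Sum>j\<in>UNIV. x $ j *\<^sub>R u j) = 0"
    then have "(\<Sum>b\<in>range u. x $ (inv u b) *\<^sub>R b) = 0"
      using assms(1) by (simp add: sum.reindex)
    then have "x $ (inv u (u j)) = 0" for j
      using assms(2) independentD[of "range u" "range u" "\<lambda>b. x $ inv u b" "u j"] by simp
    then show "x = 0" using assms(1) by (simp add: vec_eq_iff)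
  qed
qed

text \<open>Otherwise there are k independent short vectors. Being finitely many, they leave room
  for some l strictly between their coordinates and the k-th minimum, and the dilate by l contains 0
  and k independent lattice points. Because of this room, no appeal is made to the infimum being
  attained.\<close>

lemma dim_short_vectors:
  fixes v :: "nat \<Rightarrow> real ^ 'n" and e :: "'n \<Rightarrow> nat"
  assumes e: "inj e" "\<And>j. e j < m" and ind: "inj (v \<circ> e)" "independent (range (v \<circ> e))"
    and k: "1 \<le> k" and pos: "0 < succ_min k (diff_body (zonotope v m))"
  shows "dim {x :: real ^ 'n. (\<Sum>j\<in>UNIV. x $ j *\<^sub>R v (e j)) \<in> lattice \<and>
    (\<forall>i. \<bar>x $ i\<bar> < succ_min k (diff_body (zonotope v m)))} < k"
proof (rule ccontr)
  let ?D = "diff_body (zonotope v m)" and ?f = "\<lambda>x :: real ^ 'n. \<Sum>j\<in>UNIV. x $ j *\<^sub>R v (e j)"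
  let ?V = "{x. ?f x \<in> lattice \<and> (\<forall>i. \<bar>x $ i\<bar> < succ_min k ?D)}"
  have f: "linear ?f" "inj ?f" using independent_coordinates[OF ind] by (simp_all add: o_def)
  assume "\<not> dim ?V < k"
  then have kV: "k \<le> dim ?V" by simp
  obtain B where B: "B \<subseteq> ?V" "independent B" "?V \<subseteq> span B" "card B = dim ?V"
    by (rule basis_exists)
  have "k \<le> card B" using kV B(4) by simp
  then obtain C where C: "C \<subseteq> B" "card C = k" "finite C"
    by (rule obtain_subset_with_card_n)
  define M where "M = (\<lambda>(x, i). \<bar>x $ i\<bar>) ` (C \<times> UNIV)"
  have "finite M" unfolding M_def using C(3) by simp
  have "C \<noteq> {}" using C(2) k by auto
  then have "M \<noteq> {}" by (auto simp: M_def)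
  have M: "Max M < succ_min k ?D"
    using Max_in[OF \<open>finite M\<close> \<open>M \<noteq> {}\<close>] B(1) C(1) by (auto simp: M_def)
  obtain l where l: "max 0 (Max M) < l" "l < succ_min k ?D"
    using dense[of "max 0 (Max M)" "succ_min k ?D"] M pos by auto
  have small: "\<bar>x $ i\<bar> \<le> l" if "x \<in> C" for x i
  proof -
    have "\<bar>x $ i\<bar> \<in> M" using that by (auto simp: M_def image_iff)
    then show ?thesis using Max_ge[OF \<open>finite M\<close>] l(1) by fastforce
  qed
  have l0: "0 < l" using l(1) by simp
  let ?S = "((*\<^sub>R) l ` ?D) \<inter> lattice"
  \<comment> \<open>With 0 included, affine and linear dimension agree.\<close>
  have sub: "insert 0 (?f ` C) \<subseteq> ?S"
  proof -
    have "?f 0 \<in> (*\<^sub>R) l ` ?D" using l0 by (intro scaled_diff_body_zonotope e) auto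
    then have "0 \<in> ?S" by (simp add: zero_in_lattice)
    moreover have "?f x \<in> ?S" if "x \<in> C" for x
      using scaled_diff_body_zonotope[OF e l0, of x v] small[OF that] that B(1) C(1) by auto
    ultimately show ?thesis by auto
  qed
  have indC: "independent (?f ` C)"
    using linear_independent_injective_image[OF f(1) independent_mono[OF B(2) C(1)]] f(2)
    by (simp add: inj_on_subset)
  have "int k = int (card (?f ` C))" using C f(2) by (simp add: card_image inj_on_subset)
  also have "\<dots> = int (dim (insert 0 (?f ` C)))" using indC by (simp add: dim_insert span_zero dim_eq_card_independent)
  also have "\<dots> = aff_dim (insert 0 (?f ` C))"
    by (rule aff_dim_zero[symmetric]) (simp add: hull_inc)
  also have "\<dots> \<le> aff_dim ?S" by (rule aff_dim_subset[OF sub])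
  finally have "l \<in> dilates k ?D" using l0 by (simp add: dilates_def)
  then show False using succ_min_le l(2) by fastforce
qed

text \<open>DZ contains 0 and the n generators chosen by \<open>e\<close>. This bounds the minima by
  1 and also supplies the nonemptiness used in their monotonicity and positivity.\<close>

lemma one_in_dilates:
  fixes v :: "nat \<Rightarrow> real ^ 'n" and e :: "'n \<Rightarrow> nat"
  assumes e: "inj e" "\<And>j. e j < m" and ind: "inj (v \<circ> e)" "independent (range (v \<circ> e))"
    and lat: "\<And>j. v (e j) \<in> lattice" and k: "k \<le> CARD('n)"
  shows "1 \<in> dilates k (diff_body (zonotope v m))"
proof -
  let ?D = "diff_body (zonotope v m)"
  let ?S = "((*\<^sub>R) 1 ` ?D) \<inter> lattice"
  have "insert 0 (range (v \<circ> e)) \<subseteq> ?S"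
  proof -
    have "(\<Sum>j\<in>UNIV. (0 :: real ^ 'n) $ j *\<^sub>R v (e j)) \<in> (*\<^sub>R) 1 ` ?D"
      by (intro scaled_diff_body_zonotope e) auto
    then have "0 \<in> ?S" by (simp add: zero_in_lattice)
    moreover have "v (e i) \<in> ?S" for i
    proof -
      have "(\<Sum>j\<in>UNIV. (axis i 1 :: real ^ 'n) $ j *\<^sub>R v (e j)) \<in> (*\<^sub>R) 1 ` ?D"
        by (intro scaled_diff_body_zonotope e) (auto simp: axis_def)
      moreover have "(\<Sum>j\<in>UNIV. (axis i 1 :: real ^ 'n) $ j *\<^sub>R v (e j)) = v (e i)"
        by (simp add: axis_def if_distrib[of "\<lambda>c. c *\<^sub>R _"] cong: if_cong)
      ultimately show ?thesis using lat by simp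
    qed
    ultimately show ?thesis by auto
  qed
  then have "aff_dim (insert 0 (range (v \<circ> e))) \<le> aff_dim ?S" by (rule aff_dim_subset)
  moreover have "aff_dim (insert 0 (range (v \<circ> e))) = int (dim (insert 0 (range (v \<circ> e))))"
    by (rule aff_dim_zero) (simp add: hull_inc)
  moreover have "dim (insert 0 (range (v \<circ> e))) = CARD('n)"
    using dim_eq_card_independent[OF ind(2)] card_image[OF ind(1)]
    by (simp only: dim_insert span_zero if_True)
  ultimately show ?thesis using k by (simp add: dilates_def)
qed

text \<open>As w is a bijection onto 1, ..., n, the image of S under w runs once through all
  i-subsets, so the bounds for the single S add up to the whole elementary symmetric
  polynomial.\<close>

lemma sum_frac_pts_le_sigma:
  fixes v :: "nat \<Rightarrow> real ^ 'n" and J :: "nat set"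
  assumes J: "J \<subseteq> {..<m}" "card J = CARD('n)" and ind: "inj_on v J" "independent (v ` J)"
    and lat: "\<forall>k<m. v k \<in> lattice"
  shows "(\<Sum>S | S \<subseteq> J \<and> card S = i. real (card (frac_pts v {} S))) \<le> sigma_Z i (zonotope v m)"
proof -
  let ?n = "CARD('n)"
  define lam where "lam k = succ_min k (diff_body (zonotope v m))" for k
  have fJ: "finite J" using J(1) finite_subset by blast
  \<comment> \<open>Coordinates are indexed by the type \<open>'n\<close>, so J is enumerated by
    it.\<close>
  then obtain e :: "'n \<Rightarrow> nat" where eJ: "bij_betw e UNIV J"
    using finite_same_card_bij[of "UNIV :: 'n set" J] J(2) by auto
  have re: "range e = J" using eJ by (simp add: bij_betw_def)
  have e: "inj e" "\<And>j. e j < m" using eJ J(1) bij_betwE[OF eJ] by (auto simp: bij_betw_def)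
  have ind': "inj (v \<circ> e)" "independent (range (v \<circ> e))"
    using ind e(1) re comp_inj_on[of e UNIV v] image_comp[of v e UNIV] by auto
  have late: "v (e j) \<in> lattice" for j using lat e(2) by blast
  have one: "1 \<in> dilates k (diff_body (zonotope v m))" if "k \<le> ?n" for k
    by (rule one_in_dilates[OF e ind' late that])
  have pos: "0 < lam k" if "k \<in> {1..?n}" for k
    unfolding lam_def using that one[of k] by (intro succ_min_pos bounded_diff_body_zonotope) auto
  have le1: "lam k \<le> 1" if "k \<in> {1..?n}" for k
    unfolding lam_def using that by (intro succ_min_le one) auto
  have mono: "lam k \<le> lam l" if "1 \<le> k" "k \<le> l" "l \<le> ?n" for k l
    unfolding lam_def using that(2) one[OF that(3)] by (intro succ_min_mono) auto
  define V where "V k = {x :: real ^ 'n. (\<Sum>j\<in>UNIV. x $ j *\<^sub>R v (e j)) \<in> lattice \<and> (\<forall>i. \<bar>x $ i\<bar> < lam k)}" for k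
  have "dim (V k) < k" if "k \<in> {1..?n}" for k
    unfolding V_def lam_def using that pos[OF that] by (intro dim_short_vectors e ind') (auto simp: lam_def)
  then obtain w a where w: "bij_betw w (UNIV :: 'n set) {1..?n}"
    and short: "\<forall>j\<in>UNIV. \<forall>x\<in>V (w j). x $ j = (\<Sum>i | i \<in> UNIV \<and> w i < w j. a j i * x $ i)"
    using triangular_elimination[of "UNIV :: 'n set" ?n V] by auto
  have wr: "w j \<in> {1..?n}" for j using bij_betwE[OF w] by simp
  have bound: "card (frac_pts v {} (e ` S)) \<le> (\<Prod>j\<in>S. 1 / lam (w j))" for S
  proof (rule card_frac_pts_bound[where a = a])
    show "inj e" by (rule e(1))
    show "v (e j) \<in> lattice" for j by (rule late)
    show "inj w" using w by (simp add: bij_betw_def)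
    show "w j \<in> {1..?n}" for j by (rule wr)
    show "0 < lam k \<and> lam k \<le> 1" if "k \<in> {1..?n}" for k using pos[OF that] le1[OF that] ..
    show "lam k \<le> lam l" if "1 \<le> k" "k \<le> l" "l \<le> ?n" for k l using that by (rule mono)
    fix x j
    assume "(\<Sum>i\<in>UNIV. x $ i *\<^sub>R v (e i)) \<in> lattice" "\<forall>i. \<bar>x $ i\<bar> < lam (w j)"
    then have "x \<in> V (w j)" by (simp add: V_def)
    from short[THEN bspec, OF UNIV_I, THEN bspec, OF this]
    show "x $ j = (\<Sum>i | w i < w j. a j i * x $ i)" by (simp only: UNIV_I simp_thms)
  qed
  have invw: "w ` inv w ` T = T" if "T \<subseteq> {1..?n}" for T
    using w that by (intro image_inv_into_cancel) (auto simp: bij_betw_def)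
  have "(\<Sum>S | S \<subseteq> J \<and> card S = i. real (card (frac_pts v {} S)))
      = (\<Sum>S | card S = i. real (card (frac_pts v {} (e ` S))))"
  proof (rule sum.reindex_bij_witness[of _ "\<lambda>S. e ` S" "\<lambda>S. inv e ` S"])
    fix S assume "S \<in> {S. S \<subseteq> J \<and> card S = i}"
    then have S: "S \<subseteq> range e" "card S = i" by (auto simp: re)
    show "e ` inv e ` S = S" using S(1) by (intro image_inv_into_cancel) auto
    then show "real (card (frac_pts v {} (e ` inv e ` S))) = real (card (frac_pts v {} S))" by simp
    have "inj_on (inv e) S" using S(1) by (intro inj_on_inv_into)
    then show "inv e ` S \<in> {S. card S = i}" using S(2) by (simp add: card_image)
  next
    fix S :: "'n set" assume "S \<in> {S. card S = i}"
    then show "e ` S \<in> {S. S \<subseteq> J \<and> card S = i}"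
      using e(1) re by (auto simp: card_image inj_on_subset)
    show "inv e ` e ` S = S" using e(1) by (simp add: image_comp)
  qed
  also have "\<dots> \<le> (\<Sum>S :: 'n set | card S = i. \<Prod>j\<in>S. 1 / lam (w j))"
    by (intro sum_mono bound)
  also have "\<dots> = (\<Sum>T | T \<subseteq> {1..?n} \<and> card T = i. \<Prod>k\<in>T. 1 / lam k)"
  proof (rule sum.reindex_bij_witness[of _ "\<lambda>T. inv w ` T" "\<lambda>S. w ` S"])
    fix S :: "'n set" assume S: "S \<in> {S. card S = i}"
    have iw: "inj w" using w by (simp add: bij_betw_def)
    then show "inv w ` w ` S = S" by (simp add: image_comp)
    show "w ` S \<in> {T. T \<subseteq> {1..?n} \<and> card T = i}"
      using S wr inj_on_subset[OF iw, of S] by (auto simp: card_image)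
    show "(\<Prod>k\<in>w ` S. 1 / lam k) = (\<Prod>j\<in>S. 1 / lam (w j))"
      using inj_on_subset[OF iw, of S] by (simp add: prod.reindex)
  next
    fix T assume T: "T \<in> {T. T \<subseteq> {1..?n} \<and> card T = i}"
    then show "w ` inv w ` T = T" by (intro invw) auto
    have "inj_on (inv w) T" using T w by (intro inj_on_inv_into) (auto simp: bij_betw_def)
    then show "inv w ` T \<in> {S. card S = i}" using T by (simp add: card_image)
  qed
  also have "\<dots> = sigma_Z i (zonotope v m)"
    by (simp add: sigma_Z_def elem_sym_def lam_def)
  finally show ?thesis .
qed

section \<open>Averaging over the n-subsets of the generators\<close>

lemma card_le_of_aff_dim_zonotope:
  fixes v :: "nat \<Rightarrow> real ^ 'n"
  assumes "aff_dim (zonotope v m) = int CARD('n)"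
  shows "CARD('n) \<le> m"
proof -
  have "zonotope v m \<subseteq> span (v ` {..<m})"
    by (auto simp: zonotope_def intro!: span_sum intro: span_scale span_base)
  then have "aff_dim (zonotope v m) \<le> aff_dim (span (v ` {..<m}))" by (rule aff_dim_subset)
  also have "\<dots> = int (dim (v ` {..<m}))" by (simp add: aff_dim_subspace)
  also have "\<dots> \<le> int (card (v ` {..<m}))" by (simp add: dim_le_card')
  also have "\<dots> \<le> int m" using card_image_le[of "{..<m}" v] by simp
  finally show ?thesis using assms by simp
qed

lemma card_supersets:
  assumes "finite A" "S \<subseteq> A" "card S \<le> n"
  shows "card {J. S \<subseteq> J \<and> J \<subseteq> A \<and> card J = n} = (card A - card S) choose (n - card S)"
proof -
  have fS: "finite S" using assms finite_subset by blast
  have "bij_betw (\<lambda>J. J - S) {J. S \<subseteq> J \<and> J \<subseteq> A \<and> card J = n} {T. T \<subseteq> A - S \<and> card T = n - card S}"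
  proof (rule bij_betw_byWitness[where f' = "\<lambda>T. T \<union> S"])
    show "(\<lambda>J. J - S) ` {J. S \<subseteq> J \<and> J \<subseteq> A \<and> card J = n} \<subseteq> {T. T \<subseteq> A - S \<and> card T = n - card S}"
      using fS by (auto simp: card_Diff_subset)
    show "(\<lambda>T. T \<union> S) ` {T. T \<subseteq> A - S \<and> card T = n - card S} \<subseteq> {J. S \<subseteq> J \<and> J \<subseteq> A \<and> card J = n}"
    proof (rule image_subsetI)
      fix T assume T: "T \<in> {T. T \<subseteq> A - S \<and> card T = n - card S}"
      then have "finite T" using assms(1) finite_subset by blast
      then have "card (T \<union> S) = n" using T fS assms(3) by (subst card_Un_disjoint) auto
      then show "T \<union> S \<in> {J. S \<subseteq> J \<and> J \<subseteq> A \<and> card J = n}" using T assms(2) by auto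
    qed
  qed auto
  then have "card {J. S \<subseteq> J \<and> J \<subseteq> A \<and> card J = n} = card {T. T \<subseteq> A - S \<and> card T = n - card S}"
    by (rule bij_betw_same_card)
  also have "\<dots> = card (A - S) choose (n - card S)" using assms(1) by (simp add: n_subsets)
  also have "card (A - S) = card A - card S" using fS assms(2) by (simp add: card_Diff_subset)
  finally show ?thesis .
qed

theorem theorem2p4:
  fixes v :: "nat \<Rightarrow> real ^ 'n" and m i :: nat
  assumes lat: "\<forall>k<m. v k \<in> lattice"
    and genpos: "\<forall>S. S \<subseteq> {..<m} \<and> card S = CARD('n) \<longrightarrow> inj_on v S \<and> independent (v ` S)"
    and fulldim: "aff_dim (zonotope v m) = int CARD('n)"
    and i: "1 \<le> i" "i \<le> CARD('n)"
  shows "ehrhart_coeff i (zonotope v m)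
           \<le> real (m choose i) / real (CARD('n) choose i) * sigma_Z i (zonotope v m)"
proof -
  let ?n = "CARD('n)" and ?\<sigma> = "sigma_Z i (zonotope v m)"
  define g where "g S = real (card (frac_pts v {} S))" for S
  let ?S = "{S. S \<subseteq> {..<m} \<and> card S = i}" and ?J = "{J. J \<subseteq> {..<m} \<and> card J = ?n}"
  \<comment> \<open>Full dimension enters here: it guarantees that there are n-subsets to average
    over.\<close>
  have m: "?n \<le> m" using card_le_of_aff_dim_zonotope[OF fulldim] .
  have fin: "finite ?S" "finite ?J" by (auto intro: finite_subset[of _ "Pow {..<m}"])
  \<comment> \<open>Double counting of the pairs S \<subseteq> J: each i-subset S lies in C(m - i, n
    - i) of the n-subsets J.\<close>
  have "(\<Sum>S\<in>?S. g S) * ((m - i) choose (?n - i)) = (\<Sum>S\<in>?S. \<Sum>J | S \<subseteq> J \<and> J \<in> ?J. g S)"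
    unfolding sum_distrib_right
  proof (rule sum.cong[OF refl])
    fix S assume S: "S \<in> ?S"
    have "{J. S \<subseteq> J \<and> J \<in> ?J} = {J. S \<subseteq> J \<and> J \<subseteq> {..<m} \<and> card J = ?n}" by auto
    then show "g S * ((m - i) choose (?n - i)) = (\<Sum>J | S \<subseteq> J \<and> J \<in> ?J. g S)"
      using card_supersets[of "{..<m}" S ?n] S i by simp
  qed
  also have "\<dots> = (\<Sum>S\<in>?S. \<Sum>J | J \<in> ?J \<and> S \<subseteq> J. g S)" by (simp add: conj_commute)
  also have "\<dots> = (\<Sum>J\<in>?J. \<Sum>S | S \<in> ?S \<and> S \<subseteq> J. g S)" using fin by (rule sum.swap_restrict)
  also have "\<dots> \<le> (\<Sum>J\<in>?J. ?\<sigma>)"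
  proof (rule sum_mono)
    fix J assume J: "J \<in> ?J"
    then have "{S. S \<in> ?S \<and> S \<subseteq> J} = {S. S \<subseteq> J \<and> card S = i}" by auto
    then show "(\<Sum>S | S \<in> ?S \<and> S \<subseteq> J. g S) \<le> ?\<sigma>"
      using sum_frac_pts_le_sigma[of J m v i] J genpos lat by (simp add: g_def)
  qed
  also have "\<dots> = real (m choose ?n) * ?\<sigma>" by (simp add: n_subsets)
  finally have main: "(\<Sum>S\<in>?S. g S) * ((m - i) choose (?n - i)) \<le> real (m choose ?n) * ?\<sigma>" .
  have "(m choose ?n) * (?n choose i) = (m choose i) * ((m - i) choose (?n - i))"
    by (rule choose_mult[OF i(2) m])
  then have ch: "real (m choose ?n) * real (?n choose i) = real (m choose i) * real ((m - i) choose (?n - i))"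
    by (metis of_nat_mult)
  have pos: "0 < real ((m - i) choose (?n - i))" "0 < real (?n choose i)"
    using m i by (auto simp: zero_less_binomial_iff)
  have "(\<Sum>S\<in>?S. g S) \<le> real (m choose ?n) / real ((m - i) choose (?n - i)) * ?\<sigma>"
    using main pos by (simp add: field_simps)
  also have "real (m choose ?n) / real ((m - i) choose (?n - i)) = real (m choose i) / real (?n choose i)"
    using ch pos by (simp add: field_simps)
  finally show ?thesis
    by (simp add: ehrhart_coeff_zonotope[OF lat] g_def)
qed

end
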